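(* Suppose that $1 - p = \Omega(1)$, $\Delta_2^0 \le \mu/4$, and $\phi \Delta_2 = O(\Delta_3)$. Then, for every possible $Y\subset [N]$ with $|Y| = O(\mu)$, we have $$\mathbb{P}( I = Y ) = \pi^{|Y|} (1-\pi)^{N - |Y|} \, p^{-t(Y)} \exp\bigg( - \bigg( \frac{2|Y|}{\mu} - 1 \bigg) \big( \Delta_2 - \Delta_2^0 \big) + \eta'(Y) \bigg),$$ where $$\eta'(Y) = O\Big( \Delta_3 + \phi \cdot Q_2(Y) + Q_3(Y) + Q_4(Y) + \pi^2 N + C(Y) \Big).$$
   Context: Setting: $\mathcal{H}$ is an $s$-uniform hypergraph with finite vertex set $X$ and edges $E_1,\ldots,E_N$; $p\in(0,1)$; $X_p$ is the random subset of $X$ obtained by selecting each element independently with probability $p$; $A_i$ is the event $E_i\subset X_p$; $\pi=p^s$ and $\mu=\pi N$. All of these may depend on an asymptotic parameter $n\to\infty$. It is assumed that $1-\pi=\Omega(1)$ and that $\mathcal{H}$ is symmetric: for all $i,j$ there is an automorphism of $\mathcal{H}$ mapping $E_i$ to $E_j$. The random set under study is $I=\{i\in[N]: A_i \text{ holds}\}$. A set $Y\subset[N]$ is possible if $\mathbb{P}(I=Y)>0$. Write $i\sim j$ if $i\ne j$ and $E_i\cap E_j\neq\emptyset$. A $k$-cluster is a set $S\subset[N]$ with $|S|=k$ on which the relation $\sim$ induces a connected graph. $\Delta_k$ is the expected number of $k$-clusters $S$ with $S\subset I$; in particular $\Delta_2=\frac12\sum_{i\sim j}\mathbb{P}(A_i\cap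 A_j)$ (sum over ordered pairs). Also $$\Delta_2^0=\frac12\sum_{i\sim j}\mathbb{P}(A_i)\mathbb{P}(A_j),\qquad \phi=\max_{i\ne j}\mathbb{P}(A_i\mid A_j).$$ For $Y\subset[N]$ let $R(Y)=\bigcup_{j\in Y}E_j$, $t(Y)=s|Y|-|R(Y)|$, and $$Q_2(Y)=\frac12\sum_{i\sim j}\mathbf{1}[i,j\in Y],\qquad Q_3(Y)=\sum_{(i,j,k)}\mathbf{1}[i,j\in Y]\,\mathbb{P}(A_k\mid A_i),$$ where the second sum is over ordered triples of distinct indices such that $\{i,j,k\}$ is a 3-cluster, and $$Q_4(Y)=\sum_{\substack{i\sim i'\sim j'\sim j\\ i'\not\sim j,\ i\not\sim j'}}\mathbf{1}[i,j\in Y]\,\mathbb{P}(A_{i'}\cap A_{j'}\mid A_i\cap A_j),$$ the sum being over 4-tuples $(i,i',j',j)$ of distinct indices with the given intersection structure. An index $j\in[N]\setminus Y$ is complex (with respect to $Y$) if there are at least two $i\in Y$ with $i\sim j$, and $$C(Y)=\sum_{j\text{ complex}}p^{|E_j\setminus R(Y)|}.$$ The implicit constant in the conclusion depends only on the implicit constants in the hypotheses. *)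

theory Defs
  imports "HOL-Probability.Probability"
begin

text \<open>
  Hypergraphs are given by a vertex set \<open>X\<close>, a number of edges \<open>N\<close> and an enumeration
  \<open>E 1, \<dots>, E N\<close> of the (pairwise distinct) edges.
\<close>

definition uniform_hypergraph :: "'a set \<Rightarrow> nat \<Rightarrow> (nat \<Rightarrow> 'a set) \<Rightarrow> nat \<Rightarrow> bool" where
  "uniform_hypergraph X N E s \<longleftrightarrow>
     finite X \<and> inj_on E {1..N} \<and> (\<forall>i\<in>{1..N}. E i \<subseteq> X \<and> card (E i) = s)"

definition hypergraph_automorphism ::
    "'a set \<Rightarrow> nat \<Rightarrow> (nat \<Rightarrow> 'a set) \<Rightarrow> ('a \<Rightarrow> 'a) \<Rightarrow> bool" where
  "hypergraph_automorphism X N E \<sigma> \<longleftrightarrow>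
     bij_betw \<sigma> X X \<and> (\<lambda>e. \<sigma> ` e) ` (E ` {1..N}) = E ` {1..N}"

definition symmetric_hypergraph :: "'a set \<Rightarrow> nat \<Rightarrow> (nat \<Rightarrow> 'a set) \<Rightarrow> bool" where
  "symmetric_hypergraph X N E \<longleftrightarrow>
     (\<forall>i\<in>{1..N}. \<forall>j\<in>{1..N}. \<exists>\<sigma>. hypergraph_automorphism X N E \<sigma> \<and> \<sigma> ` E i = E j)"

definition binomial_subset :: "'a set \<Rightarrow> real \<Rightarrow> 'a set pmf" where
  "binomial_subset X p =
     map_pmf (\<lambda>f. {x \<in> X. f x}) (Pi_pmf X False (\<lambda>_. bernoulli_pmf p))"

definition contained_edges :: "nat \<Rightarrow> (nat \<Rightarrow> 'a set) \<Rightarrow> 'a set \<Rightarrow> nat set" where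
  "contained_edges N E W = {i \<in> {1..N}. E i \<subseteq> W}"

definition prob_contained_eq ::
    "'a set \<Rightarrow> nat \<Rightarrow> (nat \<Rightarrow> 'a set) \<Rightarrow> real \<Rightarrow> nat set \<Rightarrow> real" where
  "prob_contained_eq X N E p Y =
     measure_pmf.prob (binomial_subset X p) {W. contained_edges N E W = Y}"

definition possible :: "'a set \<Rightarrow> nat \<Rightarrow> (nat \<Rightarrow> 'a set) \<Rightarrow> real \<Rightarrow> nat set \<Rightarrow> bool" where
  "possible X N E p Y \<longleftrightarrow> Y \<subseteq> {1..N} \<and> prob_contained_eq X N E p Y > 0"

definition \<mu> :: "nat \<Rightarrow> nat \<Rightarrow> real \<Rightarrow> real" where
  "\<mu> N s p = p ^ s * real N"

definition adj :: "(nat \<Rightarrow> 'a set) \<Rightarrow> nat \<Rightarrow> nat \<Rightarrow> bool" where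
  "adj E i j \<longleftrightarrow> i \<noteq> j \<and> E i \<inter> E j \<noteq> {}"

definition cluster :: "nat \<Rightarrow> (nat \<Rightarrow> 'a set) \<Rightarrow> nat \<Rightarrow> nat set \<Rightarrow> bool" where
  "cluster N E k S \<longleftrightarrow> S \<subseteq> {1..N} \<and> card S = k \<and>
     (\<forall>i\<in>S. \<forall>j\<in>S. (i, j) \<in> {(a, b). a \<in> S \<and> b \<in> S \<and> adj E a b}\<^sup>*)"

definition \<Delta> :: "'a set \<Rightarrow> nat \<Rightarrow> (nat \<Rightarrow> 'a set) \<Rightarrow> real \<Rightarrow> nat \<Rightarrow> real" where
  "\<Delta> X N E p k = measure_pmf.expectation (binomial_subset X p)
     (\<lambda>W. real (card {S. cluster N E k S \<and> S \<subseteq> contained_edges N E W}))"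

definition \<Delta>2_0 :: "'a set \<Rightarrow> nat \<Rightarrow> (nat \<Rightarrow> 'a set) \<Rightarrow> real \<Rightarrow> real" where
  "\<Delta>2_0 X N E p =
     1 / 2 * (\<Sum>(i, j) \<in> {(i, j). i \<in> {1..N} \<and> j \<in> {1..N} \<and> adj E i j}.
       \<P>(W in binomial_subset X p. E i \<subseteq> W) * \<P>(W in binomial_subset X p. E j \<subseteq> W))"

text \<open>
  For \<open>N \<le> 1\<close> the maximum is over the empty set and hence unspecified; this is harmless, as
  \<open>\<phi>\<close> only occurs multiplied by \<open>\<Delta> 2\<close> or \<open>Q2 Y\<close>, which vanish in that case.
\<close>
definition \<phi> :: "'a set \<Rightarrow> nat \<Rightarrow> (nat \<Rightarrow> 'a set) \<Rightarrow> real \<Rightarrow> real" where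
  "\<phi> X N E p =
     Max {\<P>(W in binomial_subset X p. E i \<subseteq> W \<bar> E j \<subseteq> W) | i j.
            i \<in> {1..N} \<and> j \<in> {1..N} \<and> i \<noteq> j}"

definition R :: "(nat \<Rightarrow> 'a set) \<Rightarrow> nat set \<Rightarrow> 'a set" where
  "R E Y = (\<Union>j\<in>Y. E j)"

definition t :: "(nat \<Rightarrow> 'a set) \<Rightarrow> nat \<Rightarrow> nat set \<Rightarrow> int" where
  "t E s Y = int s * int (card Y) - int (card (R E Y))"

definition Q2 :: "(nat \<Rightarrow> 'a set) \<Rightarrow> nat set \<Rightarrow> real" where
  "Q2 E Y = 1 / 2 * real (card {(i, j). i \<in> Y \<and> j \<in> Y \<and> adj E i j})"

definition Q3 :: "'a set \<Rightarrow> nat \<Rightarrow> (nat \<Rightarrow> 'a set) \<Rightarrow> real \<Rightarrow> nat set \<Rightarrow> real" where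
  "Q3 X N E p Y =
     (\<Sum>(i, j, k) \<in> {(i, j, k). i \<in> Y \<and> j \<in> Y \<and> k \<in> {1..N} \<and>
                       distinct [i, j, k] \<and> cluster N E 3 {i, j, k}}.
       \<P>(W in binomial_subset X p. E k \<subseteq> W \<bar> E i \<subseteq> W))"

definition Q4 :: "'a set \<Rightarrow> nat \<Rightarrow> (nat \<Rightarrow> 'a set) \<Rightarrow> real \<Rightarrow> nat set \<Rightarrow> real" where
  "Q4 X N E p Y =
     (\<Sum>(i, i', j', j) \<in> {(i, i', j', j). i \<in> Y \<and> j \<in> Y \<and> i' \<in> {1..N} \<and> j' \<in> {1..N} \<and>
                            distinct [i, i', j', j] \<and>
                            adj E i i' \<and> adj E i' j' \<and> adj E j' j \<and>
                            \<not> adj E i' j \<and> \<not> adj E i j'}.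
       \<P>(W in binomial_subset X p. E i' \<subseteq> W \<and> E j' \<subseteq> W \<bar> E i \<subseteq> W \<and> E j \<subseteq> W))"

definition complex_index :: "nat \<Rightarrow> (nat \<Rightarrow> 'a set) \<Rightarrow> nat set \<Rightarrow> nat \<Rightarrow> bool" where
  "complex_index N E Y j \<longleftrightarrow> j \<in> {1..N} - Y \<and> card {i \<in> Y. adj E i j} \<ge> 2"

definition complex_sum :: "nat \<Rightarrow> (nat \<Rightarrow> 'a set) \<Rightarrow> real \<Rightarrow> nat set \<Rightarrow> real" where
  "complex_sum N E p Y = (\<Sum>j \<in> {j. complex_index N E Y j}. p ^ card (E j - R E Y))"

end

theory Submission
  imports Defs
begin

text \<open>
  Conditionally on \<open>R(Y) \<subseteq> X\<^sub>p\<close>, the event \<open>I = Y\<close> says that none of the traces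
  \<open>E\<^sub>j \<setminus> R(Y)\<close>, \<open>j \<notin> Y\<close>, is contained in \<open>X\<^sub>p\<close>. The indices outside \<open>Y\<close> are split into those
  without a neighbour in \<open>Y\<close> (isolated), with exactly one (simple) and with several (complex).
  For the isolated ones, the chain rule expresses the avoidance probability as a product whose
  factors are expanded to second order; the condition \<open>\<Delta>\<^sub>2\<^sup>0 \<le> \<mu>/4\<close> keeps the denominators
  of the conditional probabilities bounded below. For a simple index \<open>j\<close> with neighbour \<open>i\<close>,
  first order suffices: its trace has probability \<open>P(A\<^sub>j | A\<^sub>i)\<close>, and by symmetry the sum of
  \<open>P(A\<^sub>j | A\<^sub>i) - \<pi>\<close> over \<open>j \<sim> i\<close> is \<open>2(\<Delta>\<^sub>2 - \<Delta>\<^sub>2\<^sup>0)/\<mu>\<close> for every \<open>i \<in> Y\<close>. Complex indices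
  are dropped in the upper bound and cost at most a factor \<open>exp(O(C(Y)))\<close> in the lower bound.
\<close>

section \<open>Avoidance probabilities of binomial random subsets\<close>

text \<open>The difference Delta_2 - Delta_2^0 may be large, so Bonferroni sums over all of [N]
  would be useless. Every inclusion-exclusion step is therefore taken only over the indices meeting
  one given set, and all its terms are measured against the avoidance probability \<open>Z\<close>
  of the remaining indices. Errors are then relative and add up under the logarithm. The orders of
  expansion differ because the pair sum over the isolated indices is itself of the size of Delta_2 -
  Delta_2^0 and must be kept. A simple index arises from some y in Y, so a pair of intersecting
  traces involves a third edge. Summed over Y, such pairs carry the weight |Y|/(N pi) <= L and form
  3-clusters, hence O(Delta_3), unless the two traces hang on different members of Y, which is the
  case measured by Q_4.\<close>

lemma binomial_subset_insert:
  assumes "finite X" "x \<notin> X"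
  shows "binomial_subset (insert x X) p =
    bernoulli_pmf p \<bind> (\<lambda>b. map_pmf (\<lambda>W. if b then insert x W else W) (binomial_subset X p))"
proof -
  have eq: "{y. (y = x \<or> y \<in> X) \<and> (if y = x then b else f y)} =
      (if b then insert x {y \<in> X. f y} else {y \<in> X. f y})" for b and f :: "'a \<Rightarrow> bool"
    using assms by auto
  show ?thesis
    unfolding binomial_subset_def Pi_pmf_insert[OF assms] pair_pmf_def
    by (simp add: map_pmf_def bind_assoc_pmf bind_return_pmf fun_upd_def eq)
qed

lemma prob_binomial_subset_insert:
  assumes "finite X" "x \<notin> X" "0 \<le> p" "p \<le> 1"
  shows "measure_pmf.prob (binomial_subset (insert x X) p) {W. Q W} =
    p * measure_pmf.prob (binomial_subset X p) {W. Q (insert x W)} +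
    (1 - p) * measure_pmf.prob (binomial_subset X p) {W. Q W}"
proof -
  have prob_eq: "measure_pmf.prob M {W. P W} = pmf (map_pmf P M) True" for M :: "'a set pmf" and P
    by (simp add: pmf_map vimage_def)
  show ?thesis
    unfolding prob_eq using assms
    by (simp add: binomial_subset_insert map_bind_pmf pmf_bind pmf.map_comp o_def)
qed

lemma set_binomial_subset: "W \<in> set_pmf (binomial_subset X p) \<Longrightarrow> W \<subseteq> X"
  by (auto simp: binomial_subset_def)

lemma prob_binomial_subset_mem:
  assumes "finite X" "x \<in> X" "0 \<le> p" "p \<le> 1"
  shows "measure_pmf.prob (binomial_subset X p) {W. x \<in> W \<and> Q W} =
    p * measure_pmf.prob (binomial_subset X p) {W. Q (insert x W)}"
proof -
  obtain X' where X: "X = insert x X'" "x \<notin> X'"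
    using assms(2) by (meson Set.set_insert)
  have "measure_pmf.prob (binomial_subset X' p) {W. x \<in> W \<and> Q W} = 0"
    using set_binomial_subset[of _ X' p] X(2) by (auto simp: measure_pmf_zero_iff)
  then show ?thesis
    using assms X prob_binomial_subset_insert[of X' x p "\<lambda>W. x \<in> W \<and> Q W"]
      prob_binomial_subset_insert[of X' x p "\<lambda>W. Q (insert x W)"]
    by (simp add: algebra_simps)
qed

text \<open>Forcing the elements of \<open>F\<close> into the random set costs p^|F| and leaves the
  law of the rest unchanged. Later conditioning is thus the substitution of
  \<open>F \<union> W\<close> for \<open>W\<close>.\<close>

lemma prob_binomial_subset_superset:
  assumes "finite X" "F \<subseteq> X" "0 \<le> p" "p \<le> 1"
  shows "measure_pmf.prob (binomial_subset X p) {W. F \<subseteq> W \<and> Q W} =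
    p ^ card F * measure_pmf.prob (binomial_subset X p) {W. Q (F \<union> W)}"
proof -
  have "finite F" using assms(1,2) finite_subset by blast
  then show ?thesis using assms(2)
  proof (induction F arbitrary: Q rule: finite_induct)
    case empty
    then show ?case by simp
  next
    case (insert x F)
    have "measure_pmf.prob (binomial_subset X p) {W. insert x F \<subseteq> W \<and> Q W}
      = measure_pmf.prob (binomial_subset X p) {W. F \<subseteq> W \<and> x \<in> W \<and> Q W}"
      by (rule arg_cong[where f = "measure_pmf.prob _"]) auto
    also have "\<dots> = p ^ card F * measure_pmf.prob (binomial_subset X p) {W. x \<in> W \<and> Q (F \<union> W)}"
      using insert by (subst insert.IH) auto
    also have "\<dots> = p ^ card (insert x F) * measure_pmf.prob (binomial_subset X p) {W. Q (insert x F \<union> W)}"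
      using insert assms by (simp add: prob_binomial_subset_mem)
    finally show ?case .
  qed
qed

section \<open>Inclusion-exclusion relative to avoidance probabilities\<close>

locale binomial_model =
  fixes X :: "'a set" and p :: real
  assumes finite_X: "finite X" and p_pos: "0 < p" and p_less_1: "p < 1"
begin

abbreviation pr :: "('a set \<Rightarrow> bool) \<Rightarrow> real" where
  "pr P \<equiv> measure_pmf.prob (binomial_subset X p) {W. P W}"

lemma pr_mono: "(\<And>W. P W \<Longrightarrow> P' W) \<Longrightarrow> pr P \<le> pr P'"
  by (intro measure_pmf.finite_measure_mono) auto

lemma pr_split: "pr P = pr (\<lambda>W. P W \<and> P' W) + pr (\<lambda>W. P W \<and> \<not> P' W)"
  by (subst measure_pmf.finite_measure_Union[symmetric])
    (auto intro!: arg_cong[where f = "measure_pmf.prob _"])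

lemma pr_superset:
  assumes "F \<subseteq> X"
  shows "pr (\<lambda>W. F \<subseteq> W \<and> P W) = p ^ card F * pr (\<lambda>W. P (F \<union> W))"
  using prob_binomial_subset_superset[OF finite_X assms] p_pos p_less_1 by simp

lemma pr_superset_only: "F \<subseteq> X \<Longrightarrow> pr (\<lambda>W. F \<subseteq> W) = p ^ card F"
  using pr_superset[of F "\<lambda>_. True"] by simp

definition avoid :: "(nat \<Rightarrow> 'a set) \<Rightarrow> 'a set \<Rightarrow> nat set \<Rightarrow> real" where
  "avoid G F K = pr (\<lambda>W. F \<subseteq> W \<and> (\<forall>k\<in>K. \<not> G k \<subseteq> W))"

abbreviation Z :: "(nat \<Rightarrow> 'a set) \<Rightarrow> nat set \<Rightarrow> real" where
  "Z G \<equiv> avoid G {}"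

lemma avoid_nonneg [simp]: "avoid G F K \<ge> 0"
  by (simp add: avoid_def)

lemma Z_empty [simp]: "Z G {} = 1"
  by (simp add: avoid_def)

lemma avoid_antimono: "K \<subseteq> K' \<Longrightarrow> avoid G F K' \<le> avoid G F K"
  unfolding avoid_def by (rule pr_mono) auto

lemma avoid_cong: "(\<And>k. k \<in> K \<Longrightarrow> G k = G' k) \<Longrightarrow> avoid G F K = avoid G' F K"
  unfolding avoid_def by (auto intro!: arg_cong[where f = "measure_pmf.prob _"])

lemma avoid_insert: "avoid G F (insert i K) = avoid G F K - avoid G (F \<union> G i) K"
  using pr_split[of "\<lambda>W. F \<subseteq> W \<and> (\<forall>k\<in>K. \<not> G k \<subseteq> W)" "\<lambda>W. G i \<subseteq> W"]
  unfolding avoid_def by (simp add: conj_ac)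

text \<open>Monotonicity in the base set plays the role of Harris' inequality here.\<close>
lemma avoid_le: "F \<subseteq> X \<Longrightarrow> avoid G F K \<le> p ^ card F * Z G K"
  using p_pos unfolding avoid_def by (subst pr_superset) (auto intro!: mult_left_mono pr_mono)

lemma avoid_disjoint:
  assumes "F \<subseteq> X" "\<And>k. k \<in> K \<Longrightarrow> G k \<inter> F = {}"
  shows "avoid G F K = p ^ card F * Z G K"
proof -
  have "(\<forall>k\<in>K. \<not> G k \<subseteq> F \<union> W) \<longleftrightarrow> (\<forall>k\<in>K. \<not> G k \<subseteq> W)" for W
    using assms(2) by blast
  then show ?thesis
    unfolding avoid_def by (simp add: pr_superset[OF assms(1)])
qed

lemma Z_pos:
  assumes "\<And>k. k \<in> K \<Longrightarrow> G k \<noteq> {}"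
  shows "Z G K > 0"
proof -
  have "(\<lambda>_. False) \<in> set_pmf (Pi_pmf X False (\<lambda>_. bernoulli_pmf p))"
    using finite_X p_pos p_less_1 by (simp add: set_Pi_pmf PiE_dflt_def set_pmf_bernoulli)
  then have "{} \<in> set_pmf (binomial_subset X p)"
    unfolding binomial_subset_def set_map_pmf by (rule image_eqI[rotated]) simp
  then have "set_pmf (binomial_subset X p) \<inter> {W. {} \<subseteq> W \<and> (\<forall>k\<in>K. \<not> G k \<subseteq> W)} \<noteq> {}"
    using assms by blast
  then show ?thesis
    unfolding avoid_def by (simp add: measure_pmf_zero_iff zero_less_measure_iff)
qed

text \<open>A union bound over \<open>D\<close> performed on top of avoiding \<open>I\<close>: by
  \<open>avoid_le\<close> each removed term is charged \<open>Z G I\<close> instead of 1, so the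
  loss is relative to the probability already present.\<close>

lemma avoid_ge:
  assumes "finite D" "F \<subseteq> X" "\<And>i. i \<in> D \<Longrightarrow> G i \<subseteq> X"
  shows "avoid G F (D \<union> I) \<ge> avoid G F I - (\<Sum>i\<in>D. p ^ card (F \<union> G i)) * Z G I"
  using assms(1,3)
proof (induction D rule: finite_induct)
  case empty
  then show ?case by simp
next
  case (insert i D)
  have "avoid G (F \<union> G i) (D \<union> I) \<le> avoid G (F \<union> G i) I"
    by (rule avoid_antimono) auto
  also have "\<dots> \<le> p ^ card (F \<union> G i) * Z G I"
    using insert.prems assms(2) by (intro avoid_le) auto
  finally show ?case
    using insert by (simp add: avoid_insert algebra_simps)
qed

text \<open>The second Bonferroni inequality, again relative to \<open>Z G I\<close>; the excess at
  each insertion is controlled by \<open>avoid_ge\<close>. Pairs are ordered, so each is counted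
  twice, which affects only constants.\<close>

lemma avoid_le_second_order:
  assumes "finite D" "F \<subseteq> X" "\<And>i. i \<in> D \<Longrightarrow> G i \<subseteq> X"
  shows "avoid G F (D \<union> I) \<le> avoid G F I - (\<Sum>i\<in>D. avoid G (F \<union> G i) I) +
    (\<Sum>i\<in>D. \<Sum>k\<in>D - {i}. p ^ card (F \<union> G i \<union> G k)) * Z G I"
  using assms(1,3)
proof (induction D rule: finite_induct)
  case empty
  then show ?case by simp
next
  case (insert i D)
  let ?w = "\<lambda>j k. p ^ card (F \<union> G j \<union> G k)"
  have "avoid G (F \<union> G i) (D \<union> I) \<ge> avoid G (F \<union> G i) I - (\<Sum>k\<in>D. ?w i k) * Z G I"
    using insert assms(2) by (intro avoid_ge) auto
  moreover have "(\<Sum>j\<in>insert i D. \<Sum>k\<in>insert i D - {j}. ?w j k) \<ge>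
      (\<Sum>k\<in>D. ?w i k) + (\<Sum>j\<in>D. \<Sum>k\<in>D - {j}. ?w j k)"
  proof -
    have "(\<Sum>k\<in>insert i D - {j}. ?w j k) \<ge> (\<Sum>k\<in>D - {j}. ?w j k)" for j
      using insert(1) p_pos by (intro sum_mono2) auto
    then have "(\<Sum>j\<in>D. \<Sum>k\<in>insert i D - {j}. ?w j k) \<ge> (\<Sum>j\<in>D. \<Sum>k\<in>D - {j}. ?w j k)"
      by (rule sum_mono)
    moreover have "insert i D - {i} = D" using insert by auto
    ultimately show ?thesis using insert by simp
  qed
  then have "((\<Sum>k\<in>D. ?w i k) + (\<Sum>j\<in>D. \<Sum>k\<in>D - {j}. ?w j k)) * Z G I \<le>
     (\<Sum>j\<in>insert i D. \<Sum>k\<in>insert i D - {j}. ?w j k) * Z G I"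
    by (rule mult_right_mono) simp
  moreover have "avoid G F (D \<union> I) \<le> avoid G F I - (\<Sum>i\<in>D. avoid G (F \<union> G i) I) +
      (\<Sum>j\<in>D. \<Sum>k\<in>D - {j}. ?w j k) * Z G I"
    using insert by simp
  ultimately show ?case
    using insert(1,2) by (simp add: avoid_insert algebra_simps)
qed

lemma avoid_ge_disjoint:
  assumes "finite K" "F \<subseteq> X" "\<And>i. i \<in> K \<Longrightarrow> G i \<subseteq> X"
  defines "D \<equiv> {i \<in> K. G i \<inter> F \<noteq> {}}"
  shows "avoid G F K \<ge> (p ^ card F - (\<Sum>i\<in>D. p ^ card (F \<union> G i))) * Z G (K - D)"
proof -
  have "avoid G F (D \<union> (K - D)) \<ge> avoid G F (K - D) - (\<Sum>i\<in>D. p ^ card (F \<union> G i)) * Z G (K - D)"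
    using assms by (intro avoid_ge) (auto simp: D_def)
  moreover have "avoid G F (K - D) = p ^ card F * Z G (K - D)"
    using assms by (intro avoid_disjoint) (auto simp: D_def)
  moreover have "D \<union> (K - D) = K" by (auto simp: D_def)
  ultimately show ?thesis by (simp add: algebra_simps)
qed

text \<open>A nonnegative prefactor allows \<open>Z G (K - D)\<close> to be lowered to
  \<open>Z G K\<close>; with a negative one the right-hand side is at most 0. All terms are now
  compared with the same family \<open>K\<close>.\<close>

lemma avoid_ge_intersecting:
  assumes "finite K" "F \<subseteq> X" "\<And>i. i \<in> K \<Longrightarrow> G i \<subseteq> X"
  defines "D \<equiv> {i \<in> K. G i \<inter> F \<noteq> {}}"
  shows "avoid G F K \<ge> (p ^ card F - (\<Sum>i\<in>D. p ^ card (F \<union> G i))) * Z G K"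
proof (cases "p ^ card F - (\<Sum>i\<in>D. p ^ card (F \<union> G i)) \<ge> 0")
  case True
  have "Z G K \<le> Z G (K - D)" by (rule avoid_antimono) auto
  with True avoid_ge_disjoint[OF assms(1-3)] show ?thesis
    unfolding D_def by (meson mult_left_mono order_trans)
next
  case False
  then have "(p ^ card F - (\<Sum>i\<in>D. p ^ card (F \<union> G i))) * Z G K \<le> 0"
    by (intro mult_nonpos_nonneg) auto
  then show ?thesis using avoid_nonneg[of G F K] by linarith
qed

text \<open>The terms subtracted in \<open>avoid_le_second_order\<close> still involve
  \<open>I\<close>. Bounding them below by \<open>avoid_ge_intersecting\<close> costs the members of
  \<open>I\<close> that meet \<open>G i\<close>; together with the pairs inside \<open>D\<close>
  these form the single error sum.\<close>

lemma avoid_le_error: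
  assumes "finite D" "finite I" "D \<inter> I = {}" "F \<subseteq> X" "\<And>i. i \<in> D \<union> I \<Longrightarrow> G i \<subseteq> X"
    and dis: "\<And>i. i \<in> I \<Longrightarrow> G i \<inter> F = {}"
  shows "avoid G F (D \<union> I) \<le> (p ^ card F - (\<Sum>i\<in>D. p ^ card (F \<union> G i)) +
    (\<Sum>i\<in>D. \<Sum>k\<in>{k \<in> D \<union> I - {i}. k \<in> D \<or> G k \<inter> G i \<noteq> {}}. p ^ card (F \<union> G i \<union> G k))) * Z G I"
proof -
  let ?w = "\<lambda>i k. p ^ card (F \<union> G i \<union> G k)"
  let ?I = "\<lambda>i. {k \<in> I. G k \<inter> (F \<union> G i) \<noteq> {}}"
  have "avoid G F (D \<union> I) \<le> avoid G F I - (\<Sum>i\<in>D. avoid G (F \<union> G i) I) +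
      (\<Sum>i\<in>D. \<Sum>k\<in>D - {i}. ?w i k) * Z G I"
    using assms by (intro avoid_le_second_order) auto
  moreover have "avoid G F I = p ^ card F * Z G I"
    using assms by (intro avoid_disjoint) auto
  moreover have "(\<Sum>i\<in>D. avoid G (F \<union> G i) I) \<ge>
      (\<Sum>i\<in>D. (p ^ card (F \<union> G i) - (\<Sum>k\<in>?I i. ?w i k)) * Z G I)"
    using assms by (intro sum_mono avoid_ge_intersecting) auto
  moreover have "(\<Sum>i\<in>D. (p ^ card (F \<union> G i) - (\<Sum>k\<in>?I i. ?w i k)) * Z G I) =
      ((\<Sum>i\<in>D. p ^ card (F \<union> G i)) - (\<Sum>i\<in>D. \<Sum>k\<in>?I i. ?w i k)) * Z G I"
    by (simp add: sum_subtractf sum_distrib_right left_diff_distrib)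
  moreover have "(\<Sum>i\<in>D. \<Sum>k\<in>{k \<in> D \<union> I - {i}. k \<in> D \<or> G k \<inter> G i \<noteq> {}}. ?w i k) =
     (\<Sum>i\<in>D. \<Sum>k\<in>?I i. ?w i k) + (\<Sum>i\<in>D. \<Sum>k\<in>D - {i}. ?w i k)"
    unfolding sum.distrib[symmetric]
  proof (intro sum.cong refl)
    fix i assume i: "i \<in> D"
    have eq: "{k \<in> D \<union> I - {i}. k \<in> D \<or> G k \<inter> G i \<noteq> {}} = ?I i \<union> (D - {i})"
      using i assms(3) dis by blast
    show "(\<Sum>k\<in>{k \<in> D \<union> I - {i}. k \<in> D \<or> G k \<inter> G i \<noteq> {}}. ?w i k) =
        (\<Sum>k\<in>?I i. ?w i k) + (\<Sum>k\<in>D - {i}. ?w i k)"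
      unfolding eq
    proof (rule sum.union_disjoint)
      show "?I i \<inter> (D - {i}) = {}" using assms(3) by blast
    qed (use assms(1,2) in simp_all)
  qed
  ultimately show ?thesis by (simp add: algebra_simps)
qed

end

section \<open>The second-order expansion for isolated edges\<close>

text \<open>
  Here \<open>q / zK\<close> is the conditional probability of an edge given that the edges in \<open>K\<close> are
  absent; \<open>z\<close> is the avoidance probability of the edges of \<open>K\<close> disjoint from it, by which
  both \<open>q\<close> and \<open>zK\<close> are normalized.
\<close>
lemma ln_ratio_bounds:
  fixes \<pi> c x y e e' z zK q :: real
  assumes pos: "\<pi> > 0" "c > 0" "1 - \<pi> \<ge> c" "z > 0" "zK > 0"
    and xy: "0 \<le> y" "y \<le> 1 / 2" "\<pi> * y \<le> x" and e: "0 \<le> e" "\<pi> * e' \<le> e"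
    and q: "(\<pi> - x) * z \<le> q" "q \<le> (\<pi> - x + e) * z" "q \<le> \<pi> * zK" "0 \<le> q"
    and zK: "(1 - y) * z \<le> zK" "zK \<le> (1 - y + e') * z" "zK \<le> z"
  defines "l \<equiv> ln (zK - q) - ln zK - ln (1 - \<pi>)"
  shows "l \<ge> x - \<pi> * y - (e + \<pi>\<^sup>2)"
    and "l \<le> x - \<pi> * y + (2 * x * y + 2 * e + \<pi> / c * (2 * x + 2 * e))"
proof -
  \<comment> \<open>The amount by which conditioning lowers the probability of the edge below \<pi>;
    \<open>l\<close> depends on q and zK through it alone.\<close>
  define \<delta> where "\<delta> = \<pi> - q / zK"
  have \<delta>0: "\<delta> \<ge> 0" using q(3) pos by (simp add: \<delta>_def field_simps)
  have l: "l = ln (1 + \<delta> / (1 - \<pi>))"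
  proof -
    have "zK - q = zK * (1 - \<pi> + \<delta>)" using pos by (simp add: \<delta>_def field_simps)
    then have "ln (zK - q) = ln zK + ln (1 - \<pi> + \<delta>)"
      using pos \<delta>0 by (simp add: ln_mult)
    moreover have "1 + \<delta> / (1 - \<pi>) = (1 - \<pi> + \<delta>) / (1 - \<pi>)"
      using pos by (simp add: field_simps)
    ultimately show ?thesis using pos \<delta>0 by (simp add: l_def ln_div)
  qed
  \<comment> \<open>Replacing \<open>z\<close> by the smaller \<open>zK\<close> respects the
    inequality only if the left-hand side is nonnegative; otherwise \<delta> being nonnegative
    already gives the claim.\<close>
  have lower: "\<delta> \<ge> x - \<pi> * y - e"
  proof (cases "x - \<pi> * y - e \<ge> 0")
    case True
    have "(x - \<pi> * y - e) * zK \<le> (x - \<pi> * y - e) * z"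
      using True zK(3) by (rule mult_left_mono[rotated])
    also have "\<dots> \<le> \<pi> * zK - q"
      using q(2) mult_left_mono[OF zK(1), of \<pi>] pos by (simp add: algebra_simps)
    also have "\<dots> = \<delta> * zK" using pos by (simp add: \<delta>_def field_simps)
    finally show ?thesis using pos by (simp add: mult_le_cancel_right)
  qed (use \<delta>0 in linarith)
  have \<delta>_le: "\<delta> \<le> (x - \<pi> * y) + (2 * x * y + 2 * e)"
  proof -
    have "\<delta> * ((1 - y) * z) \<le> \<delta> * zK" using zK(1) \<delta>0 by (rule mult_left_mono)
    also have "\<dots> = \<pi> * zK - q" using pos by (simp add: \<delta>_def field_simps)
    also have "\<dots> \<le> (x - \<pi> * y + \<pi> * e') * z"
      using q(1) mult_left_mono[OF zK(2), of \<pi>] pos by (simp add: algebra_simps)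
    also have "\<dots> \<le> (x - \<pi> * y + e) * z"
      using e pos by (intro mult_right_mono) auto
    finally have *: "\<delta> * (1 - y) \<le> x - \<pi> * y + e"
      using pos by (simp add: mult.assoc[symmetric])
    \<comment> \<open>As y is at most 1/2, the factor 1/(1 - y) is at most 1 + 2 y.\<close>
    have "\<delta> \<le> \<delta> * (1 - y) * (1 + 2 * y)"
    proof -
      have "1 \<le> (1 - y) * (1 + 2 * y)"
        using xy mult_nonneg_nonneg[of y "1 - 2 * y"] by (simp add: algebra_simps)
      then show ?thesis using \<delta>0 mult_left_mono[of 1 "(1 - y) * (1 + 2 * y)" \<delta>]
        by (simp add: mult.assoc)
    qed
    also have "\<dots> \<le> (x - \<pi> * y + e) * (1 + 2 * y)"
      using * xy by (intro mult_right_mono) auto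
    also have "\<dots> = (x - \<pi> * y) + 2 * x * y - 2 * \<pi> * y * y + e * (1 + 2 * y)"
      by (simp add: algebra_simps)
    also have "e * (1 + 2 * y) \<le> e * 2"
      using xy e by (intro mult_left_mono) auto
    also have "(x - \<pi> * y) + 2 * x * y - 2 * \<pi> * y * y \<le> (x - \<pi> * y) + 2 * x * y"
      using pos xy by simp
    finally show ?thesis by simp
  qed
  have x0: "x \<ge> 0" using xy pos by (meson mult_nonneg_nonneg less_imp_le order_trans)
  have \<delta>2: "\<delta> \<le> 2 * x + 2 * e"
  proof -
    have "2 * x * y \<le> x" using xy x0 mult_left_mono[of y "1/2" x] by simp
    moreover have "\<pi> * y \<ge> 0" using pos xy by simp
    ultimately show ?thesis using \<delta>_le by linarith
  qed
  have "l \<le> \<delta> / (1 - \<pi>)"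
    unfolding l using \<delta>0 pos by (intro ln_add_one_self_le_self) auto
  also have "\<dots> = \<delta> + \<pi> * \<delta> / (1 - \<pi>)" using pos by (simp add: field_simps)
  also have "\<pi> * \<delta> / (1 - \<pi>) \<le> \<pi> * (2 * x + 2 * e) / c"
    using pos \<delta>2 \<delta>0 by (intro frac_le mult_left_mono) auto
  finally show "l \<le> x - \<pi> * y + (2 * x * y + 2 * e + \<pi> / c * (2 * x + 2 * e))"
    using \<delta>_le by simp
  have "\<delta> - \<delta>\<^sup>2 \<le> ln (1 + \<delta>)"
  proof (cases "\<delta> \<le> 1")
    case True
    then show ?thesis using ln_one_plus_pos_lower_bound[of \<delta>] \<delta>0 by simp
  next
    case False
    then have "\<delta> \<le> \<delta>\<^sup>2" by (simp add: power2_eq_square)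
    then show ?thesis using ln_ge_zero[of "1 + \<delta>"] \<delta>0 by linarith
  qed
  also have "\<dots> \<le> l"
  proof -
    have "\<delta> \<le> \<delta> / (1 - \<pi>)" using \<delta>0 pos by (simp add: le_divide_eq mult_left_le)
    then show ?thesis unfolding l using \<delta>0 by simp
  qed
  finally have "l \<ge> \<delta> - \<delta>\<^sup>2" .
  \<comment> \<open>This crude bound, summed over at most N indices, produces the term pi^2 N of the
    final error.\<close>
  moreover have "\<delta>\<^sup>2 \<le> \<pi>\<^sup>2"
    using \<delta>0 q(4) pos by (intro power_mono) (auto simp: \<delta>_def)
  ultimately show "l \<ge> x - \<pi> * y - (e + \<pi>\<^sup>2)"
    using lower by linarith
qed

locale hypergraph_model = binomial_model X p for X :: "'a set" and p +
  fixes N :: nat and E :: "nat \<Rightarrow> 'a set" and s :: nat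
  assumes uniform: "uniform_hypergraph X N E s" and s_pos: "s > 0"
begin

lemma edge_subset: "i \<in> {1..N} \<Longrightarrow> E i \<subseteq> X"
  and card_edge: "i \<in> {1..N} \<Longrightarrow> card (E i) = s"
  and inj_edge: "inj_on E {1..N}"
  using uniform by (auto simp: uniform_hypergraph_def)

lemma finite_edge: "i \<in> {1..N} \<Longrightarrow> finite (E i)"
  using edge_subset finite_X finite_subset by blast

lemma edge_nonempty: "i \<in> {1..N} \<Longrightarrow> E i \<noteq> {}"
  using card_edge s_pos by fastforce

definition nb :: "nat \<Rightarrow> nat set" where "nb i = {j \<in> {1..N}. adj E i j}"

abbreviation w2 :: "nat \<Rightarrow> nat \<Rightarrow> real" where "w2 i j \<equiv> p ^ card (E i \<union> E j)"
abbreviation w3 :: "nat \<Rightarrow> nat \<Rightarrow> nat \<Rightarrow> real" where "w3 i j k \<equiv> p ^ card (E i \<union> E j \<union> E k)"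

text \<open>Weighted counts of pairs and of paths i ~ j ~ k: in \<open>bdeg\<close> the index i is
  an end of the path, in \<open>cdeg\<close> its middle. Over all i, \<open>adeg\<close> sums to 2
  Delta_2 and the path counts to O(Delta_3).\<close>

definition adeg :: "nat \<Rightarrow> real" where "adeg i = (\<Sum>j\<in>nb i. w2 i j)"
definition bdeg :: "nat \<Rightarrow> real" where "bdeg i = (\<Sum>j\<in>nb i. \<Sum>k\<in>nb j - {i}. w3 i j k)"
definition cdeg :: "nat \<Rightarrow> real" where "cdeg i = (\<Sum>j\<in>nb i. \<Sum>k\<in>nb i - {j}. w3 i j k)"

lemma finite_nb [simp]: "finite (nb i)" by (simp add: nb_def)

lemma nb_subset: "nb i \<subseteq> {1..N}" by (auto simp: nb_def)

lemma adj_sym: "adj E i j \<longleftrightarrow> adj E j i" by (auto simp: adj_def)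

lemma adj_irrefl [simp]: "\<not> adj E i i" by (simp add: adj_def)

lemma pow_p_nonneg [simp]: "0 \<le> p ^ n" using p_pos by simp

lemma pow_p_mono: "m \<le> n \<Longrightarrow> p ^ n \<le> p ^ m"
  using p_pos p_less_1 by (intro power_decreasing) auto

lemma pow_p_Un: "p ^ card A * p ^ card B \<le> p ^ card (A \<union> B)"
  unfolding power_add[symmetric] by (rule pow_p_mono) (rule card_Un_le)

lemma adeg_nonneg: "adeg i \<ge> 0" and bdeg_nonneg: "bdeg i \<ge> 0" and cdeg_nonneg: "cdeg i \<ge> 0"
  by (auto simp: adeg_def bdeg_def cdeg_def intro!: sum_nonneg)

text \<open>Ordered paths with two steps, counted by their middle or by their first index. Hence
  only \<open>bdeg\<close> has to be compared with Delta_3.\<close>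

lemma sum_cdeg: "(\<Sum>i\<in>{1..N}. cdeg i) = (\<Sum>i\<in>{1..N}. bdeg i)"
proof -
  have "(\<Sum>i\<in>{1..N}. cdeg i) = (\<Sum>i\<in>{1..N}. \<Sum>j | j \<in> {1..N} \<and> adj E i j. \<Sum>k\<in>nb i - {j}. w3 i j k)"
    by (simp add: cdeg_def nb_def)
  also have "\<dots> = (\<Sum>j\<in>{1..N}. \<Sum>i | i \<in> {1..N} \<and> adj E i j. \<Sum>k\<in>nb i - {j}. w3 i j k)"
    by (rule sum.swap_restrict) auto
  also have "\<dots> = (\<Sum>j\<in>{1..N}. bdeg j)"
  proof (intro sum.cong refl)
    fix j
    have "{i \<in> {1..N}. adj E i j} = nb j" by (auto simp: nb_def adj_def)
    then show "(\<Sum>i | i \<in> {1..N} \<and> adj E i j. \<Sum>k\<in>nb i - {j}. w3 i j k) = bdeg j"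
      by (simp add: bdeg_def Un_commute)
  qed
  finally show ?thesis .
qed

end

text \<open>Here \<open>f\<close> stands in for phi as a bound on P(A_j | A_i) for adjacent pairs,
  and \<open>deg_le\<close> is the form that Delta_2^0 <= mu/4 takes at a single index.\<close>

locale sparse_model = hypergraph_model X p N E s for X :: "'a set" and p N E s +
  fixes c f :: real
  assumes c_pos: "c > 0" and c_le: "c \<le> 1 - p ^ s"
    and f_nonneg: "f \<ge> 0"
    and f_ge: "\<And>i j. i \<in> {1..N} \<Longrightarrow> j \<in> {1..N} \<Longrightarrow> adj E i j \<Longrightarrow> p ^ card (E j - E i) \<le> f"
    and deg_le: "\<And>i. i \<in> {1..N} \<Longrightarrow> real (card (nb i)) * p ^ s \<le> 1 / 2"
begin

abbreviation pi_s :: real where "pi_s \<equiv> p ^ s"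

lemma pi_le_f: 
  assumes "i \<in> {1..N}" "j \<in> {1..N}" "adj E i j" shows "pi_s \<le> f"
proof -
  have "pi_s \<le> p ^ card (E j - E i)"
    using assms card_edge[of j] finite_edge[of j] by (intro pow_p_mono) (metis card_mono Diff_subset)
  with f_ge[OF assms] show ?thesis by simp
qed

text \<open>Used to charge products pi * P(A_i and A_j) to phi * Delta_2. Without neighbours of i
  the comparison \<open>pi_s \<le> f\<close> may fail, but then \<open>adeg i\<close> is 0.\<close>

lemma pi_adeg_le: assumes "i \<in> {1..N}" shows "pi_s * adeg i \<le> f * adeg i"
proof (cases "nb i = {}")
  case False
  then have "pi_s \<le> f" using pi_le_f assms by (auto simp: nb_def)
  then show ?thesis using adeg_nonneg by (rule mult_right_mono)
qed (simp add: adeg_def)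

text \<open>The ratio of the two avoidance probabilities is 1 - P(A_j | no edge of \<open>K\<close>
  is present). Let \<open>I\<close> be the part of \<open>K\<close> disjoint from
  \<open>E j\<close>. Then A_j is independent of avoiding \<open>I\<close>, so the numerator and the
  denominator of this conditional probability can both be expanded over the neighbours
  \<open>D\<close>, with the common factor \<open>Z E I\<close> that \<open>ln_ratio_bounds\<close>
  expects.\<close>

lemma ln_Z_insert:
  assumes j: "j \<in> {1..N}" and K: "K \<subseteq> {1..N}" "j \<notin> K"
  shows "\<bar>ln (Z E (insert j K)) - ln (Z E K) - ln (1 - pi_s) - (\<Sum>i\<in>K \<inter> nb j. w2 j i - pi_s\<^sup>2)\<bar>
    \<le> (4 + 2 / c) * (bdeg j + cdeg j + f * adeg j + pi_s\<^sup>2)"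
proof -
  define D where "D = K \<inter> nb j"
  define I where "I = K - D"
  define x where "x = (\<Sum>i\<in>D. w2 j i)"
  define y where "y = real (card D) * pi_s"
  define err where "err F = (\<Sum>i\<in>D. \<Sum>k\<in>{k \<in> D \<union> I - {i}. k \<in> D \<or> E k \<inter> E i \<noteq> {}}. p ^ card (F \<union> E i \<union> E k))"
    for F
  have fin: "finite K" using K finite_subset by blast
  then have finD: "finite D" "finite I" by (auto simp: D_def I_def)
  have DI: "D \<union> I = K" "D \<inter> I = {}" by (auto simp: D_def I_def)
  have sub: "E i \<subseteq> X" if "i \<in> D \<union> I" for i using that K edge_subset DI by blast
  have Dn: "D \<subseteq> nb j" "D \<subseteq> {1..N}" using nb_subset by (auto simp: D_def)
  have dis: "E i \<inter> E j = {}" if "i \<in> I" for i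
    using that K by (auto simp: I_def D_def nb_def adj_def)
  have y_alt: "y = (\<Sum>i\<in>D. p ^ card (E i))"
    using Dn by (simp add: y_def card_edge subset_iff)
  have "avoid E (E j) (D \<union> I) \<le> (pi_s - x + err (E j)) * Z E I"
    using avoid_le_error[of D I "E j" E] finD DI sub edge_subset[OF j] dis
    by (simp add: card_edge[OF j] x_def err_def)
  then have q2: "avoid E (E j) K \<le> (pi_s - x + err (E j)) * Z E I" unfolding DI .
  have "avoid E {} (D \<union> I) \<le> (1 - y + err {}) * Z E I"
    using avoid_le_error[of D I "{}" E] finD DI sub by (simp add: y_alt err_def)
  then have z2: "Z E K \<le> (1 - y + err {}) * Z E I" unfolding DI .
  have "avoid E (E j) (D \<union> I) \<ge> (pi_s - x) * Z E I"
    using avoid_ge[of D "E j" E I, OF finD(1) edge_subset[OF j] sub]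
      avoid_disjoint[of "E j" I E, OF edge_subset[OF j] dis]
    by (simp add: card_edge[OF j] x_def left_diff_distrib)
  then have q1: "avoid E (E j) K \<ge> (pi_s - x) * Z E I" unfolding DI .
  have "avoid E {} (D \<union> I) \<ge> (1 - y) * Z E I"
    using avoid_ge[of D "{}" E I, OF finD(1) _ sub] by (simp add: y_alt left_diff_distrib)
  then have z1: "Z E K \<ge> (1 - y) * Z E I" unfolding DI .
  have q3: "avoid E (E j) K \<le> pi_s * Z E K"
    using avoid_le[OF edge_subset[OF j]] by (simp add: card_edge[OF j])
  have z3: "Z E K \<le> Z E I" by (rule avoid_antimono) (auto simp: I_def)
  have Zpos: "Z E K > 0" "Z E I > 0"
    using K edge_nonempty by (auto intro!: Z_pos simp: I_def)
  have y0: "0 \<le> y" by (simp add: y_def)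
  have "y \<le> real (card (nb j)) * pi_s"
    unfolding y_def using Dn by (intro mult_right_mono) (auto intro: card_mono)
  then have y1: "y \<le> 1 / 2" using deg_le[OF j] by linarith
  have xy: "pi_s * y \<le> x"
    unfolding x_def y_alt sum_distrib_left
    by (intro sum_mono) (metis pow_p_Un card_edge[OF j])
  have e0: "err (E j) \<ge> 0" by (auto simp: err_def intro!: sum_nonneg)
  \<comment> \<open>Weights are supermultiplicative under unions, so pi times the error of the
    denominator is covered by the error of the numerator.\<close>
  have ee: "pi_s * err {} \<le> err (E j)"
    unfolding err_def sum_distrib_left
    by (intro sum_mono) (metis pow_p_Un card_edge[OF j] Un_assoc Un_empty_left)
  \<comment> \<open>Each pair (i, k) in the error extends to a path through j: if k ~ i then j is an
    end (\<open>bdeg\<close>), and if k lies in \<open>D\<close> then j is the middle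
    (\<open>cdeg\<close>).\<close>
  have e_le: "err (E j) \<le> bdeg j + cdeg j"
  proof -
    have "(\<Sum>k\<in>{k \<in> D \<union> I - {i}. k \<in> D \<or> E k \<inter> E i \<noteq> {}}. w3 j i k)
        \<le> (\<Sum>k\<in>nb i - {j}. w3 j i k) + (\<Sum>k\<in>nb j - {i}. w3 j i k)" if i: "i \<in> D" for i
    proof -
      have "(\<Sum>k\<in>{k \<in> D \<union> I - {i}. k \<in> D \<or> E k \<inter> E i \<noteq> {}}. w3 j i k) \<le>
          (\<Sum>k\<in>(nb i - {j}) \<union> (nb j - {i}). w3 j i k)"
        using i K Dn unfolding DI
        by (intro sum_mono2) (auto simp: nb_def adj_def D_def)
      also have "\<dots> \<le> (\<Sum>k\<in>nb i - {j}. w3 j i k) + (\<Sum>k\<in>nb j - {i}. w3 j i k)"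
        by (subst sum_Un) (auto intro!: sum_nonneg)
      finally show ?thesis .
    qed
    then have "err (E j) \<le> (\<Sum>i\<in>D. (\<Sum>k\<in>nb i - {j}. w3 j i k) + (\<Sum>k\<in>nb j - {i}. w3 j i k))"
      unfolding err_def by (rule sum_mono)
    also have "\<dots> \<le> (\<Sum>i\<in>nb j. (\<Sum>k\<in>nb i - {j}. w3 j i k) + (\<Sum>k\<in>nb j - {i}. w3 j i k))"
      using Dn by (intro sum_mono2) (auto intro!: sum_nonneg add_nonneg_nonneg)
    finally show ?thesis by (simp add: bdeg_def cdeg_def sum.distrib)
  qed
  have x_le: "x \<le> adeg j"
    unfolding x_def adeg_def using Dn by (intro sum_mono2) auto
  have x0: "0 \<le> x" by (auto simp: x_def intro: sum_nonneg)
  have pix: "pi_s * x \<le> f * adeg j"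
    using pi_adeg_le[OF j] mult_left_mono[OF x_le, of pi_s] by simp
  \<comment> \<open>The diagonal of the product is pi * x, absorbed by \<open>f * adeg j\<close>;
    off the diagonal two distinct neighbours of j form a path with middle j.\<close>
  have xy_le: "x * y \<le> cdeg j + f * adeg j"
  proof -
    have "x * y = (\<Sum>i\<in>D. \<Sum>k\<in>D. w2 j i * p ^ card (E k))"
      by (simp add: x_def y_alt sum_product)
    also have "\<dots> = (\<Sum>i\<in>D. \<Sum>k\<in>D - {i}. w2 j i * p ^ card (E k)) + (\<Sum>i\<in>D. w2 j i * pi_s)"
      unfolding sum.distrib[symmetric]
    proof (intro sum.cong refl)
      fix i assume "i \<in> D"
      then show "(\<Sum>k\<in>D. w2 j i * p ^ card (E k)) =
          (\<Sum>k\<in>D - {i}. w2 j i * p ^ card (E k)) + w2 j i * pi_s"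
        using finD Dn card_edge[of i] by (subst sum.remove[of D i]) auto
    qed
    also have "(\<Sum>i\<in>D. w2 j i * pi_s) = pi_s * x"
      by (simp add: x_def sum_distrib_left mult.commute)
    also have "(\<Sum>i\<in>D. \<Sum>k\<in>D - {i}. w2 j i * p ^ card (E k)) \<le> (\<Sum>i\<in>D. \<Sum>k\<in>nb j - {i}. w3 j i k)"
    proof (intro sum_mono)
      fix i assume "i \<in> D"
      have "(\<Sum>k\<in>D - {i}. w2 j i * p ^ card (E k)) \<le> (\<Sum>k\<in>D - {i}. w3 j i k)"
        by (intro sum_mono pow_p_Un)
      also have "\<dots> \<le> (\<Sum>k\<in>nb j - {i}. w3 j i k)"
        using Dn by (intro sum_mono2) auto
      finally show "(\<Sum>k\<in>D - {i}. w2 j i * p ^ card (E k)) \<le> (\<Sum>k\<in>nb j - {i}. w3 j i k)" .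
    qed
    also have "\<dots> \<le> cdeg j"
      unfolding cdeg_def using Dn by (intro sum_mono2) (auto intro!: sum_nonneg)
    finally show ?thesis using pix by simp
  qed
  define l where "l = ln (Z E K - avoid E (E j) K) - ln (Z E K) - ln (1 - pi_s)"
  have l_alt: "l = ln (Z E (insert j K)) - ln (Z E K) - ln (1 - pi_s)"
    using avoid_insert[of E "{}" j K] by (simp add: l_def)
  have main: "(\<Sum>i\<in>D. w2 j i - pi_s\<^sup>2) = x - pi_s * y"
    by (simp add: x_def y_def sum_subtractf power2_eq_square)
  have ppos: "pi_s > 0" using p_pos by simp
  note bounds = ln_ratio_bounds[OF ppos c_pos _ Zpos(2,1) y0 y1 xy e0 ee q1 q2 q3 avoid_nonneg z1 z2 z3, folded l_def]
  have cpi: "c \<le> 1 - pi_s" using c_le by simp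
  have nn: "bdeg j \<ge> 0" "cdeg j \<ge> 0" "f * adeg j \<ge> 0" "pi_s\<^sup>2 \<ge> 0"
    using adeg_nonneg bdeg_nonneg cdeg_nonneg f_nonneg by auto
  let ?u = "bdeg j + cdeg j + f * adeg j + pi_s\<^sup>2"
  have u: "?u \<ge> 0" "?u \<le> (4 + 2 / c) * ?u"
  proof -
    show "?u \<ge> 0" using nn by linarith
    then show "?u \<le> (4 + 2 / c) * ?u"
      using c_pos mult_right_mono[of 1 "4 + 2 / c" ?u] by simp
  qed
  have "l - (x - pi_s * y) \<ge> - ?u"
    using bounds(1)[OF cpi] e_le nn by linarith
  moreover have "l - (x - pi_s * y) \<le> (4 + 2 / c) * ?u"
  proof -
    have "pi_s / c * (2 * x + 2 * err (E j)) = 2 / c * (pi_s * x + pi_s * err (E j))"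
      by (simp add: field_simps)
    also have "\<dots> \<le> 2 / c * ?u"
    proof (intro mult_left_mono)
      have "pi_s * err (E j) \<le> err (E j)"
        using e0 p_pos p_less_1 by (intro mult_left_le_one_le) (auto intro: power_le_one)
      then show "pi_s * x + pi_s * err (E j) \<le> ?u" using pix e_le nn by linarith
    qed (use c_pos in auto)
    finally have "pi_s / c * (2 * x + 2 * err (E j)) \<le> 2 / c * ?u" .
    moreover have "2 * x * y + 2 * err (E j) \<le> 4 * ?u"
    proof -
      have "2 * a * b + 2 * e \<le> 4 * (d1 + d2 + d3 + d4)"
        if "a * b \<le> d2 + d3" "e \<le> d1 + d2" "0 \<le> d1" "0 \<le> d2" "0 \<le> d3" "0 \<le> d4"
        for a b e d1 d2 d3 d4 :: real
        using that by simp
      then show ?thesis using xy_le e_le nn by blast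
    qed
    ultimately show ?thesis
      using bounds(2)[OF cpi] by (simp add: distrib_right)
  qed
  ultimately have "\<bar>l - (x - pi_s * y)\<bar> \<le> (4 + 2 / c) * ?u"
    using u by (intro abs_leI) linarith+
  then show ?thesis by (simp only: l_alt main[unfolded D_def])
qed

end

section \<open>Enlarging a family of avoided sets\<close>

lemma ln_one_minus_ge:
  fixes q c :: real
  assumes "0 \<le> q" "q \<le> 1 - c" "c > 0"
  shows "ln (1 - q) \<ge> - q - q\<^sup>2 / c"
proof -
  have "1 / (1 - q) = 1 + q / (1 - q)" using assms by (simp add: field_simps)
  then have "- ln (1 - q) = ln (1 + q / (1 - q))"
    using assms by (simp add: ln_div flip: \<open>1 / (1 - q) = 1 + q / (1 - q)\<close>)
  also have "\<dots> \<le> q / (1 - q)" using assms by (intro ln_add_one_self_le_self) auto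
  also have "\<dots> = q + q\<^sup>2 / (1 - q)" using assms by (simp add: field_simps power2_eq_square)
  also have "q\<^sup>2 / (1 - q) \<le> q\<^sup>2 / c" using assms by (intro divide_left_mono) auto
  finally show ?thesis by simp
qed

context binomial_model
begin

text \<open>Each new index keeps at least the fraction 1 - p^|G j| of the probability, since
  \<open>avoid_le\<close> expresses the positive correlation of avoidance events.\<close>

lemma Z_Un_ge:
  assumes "finite J" "J \<inter> K = {}" "\<And>j. j \<in> J \<Longrightarrow> G j \<subseteq> X"
  shows "Z G (K \<union> J) \<ge> Z G K * (\<Prod>j\<in>J. 1 - p ^ card (G j))"
  using assms
proof (induction J rule: finite_induct)
  case empty
  then show ?case by simp
next
  case (insert j J)
  let ?q = "p ^ card (G j)"
  have q: "?q \<le> 1" using p_pos p_less_1 by (intro power_le_one) auto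
  have "Z G K * (\<Prod>j\<in>insert j J. 1 - p ^ card (G j)) \<le> Z G (K \<union> J) * (1 - ?q)"
    using insert q by (simp add: mult.commute[of "1 - ?q"] mult_right_mono mult.assoc[symmetric])
  also have "\<dots> \<le> Z G (insert j (K \<union> J))"
    using avoid_le[of "G j" G "K \<union> J"] insert.prems by (simp add: avoid_insert algebra_simps)
  finally show ?case by simp
qed

text \<open>By \<open>avoid_ge_intersecting\<close> a new index keeps at most the fraction 1 + v j -
  p^|G j|, which is below the exponential for either sign. Since \<open>v j\<close> bounds the sum
  over all of \<open>K \<union> J\<close>, it serves at whatever stage j is inserted.\<close>

lemma Z_Un_le:
  assumes fin: "finite J" "finite K" and sub: "\<And>j. j \<in> K \<union> J \<Longrightarrow> G j \<subseteq> X"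
    and v: "\<And>j. j \<in> J \<Longrightarrow>
      (\<Sum>i\<in>{i \<in> K \<union> J - {j}. G i \<inter> G j \<noteq> {}}. p ^ card (G j \<union> G i)) \<le> v j"
    and "J \<inter> K = {}"
  shows "Z G (K \<union> J) \<le> Z G K * exp (\<Sum>j\<in>J. v j - p ^ card (G j))"
proof -
  have "Z G (K \<union> J') \<le> Z G K * exp (\<Sum>j\<in>J'. v j - p ^ card (G j))" if "J' \<subseteq> J" for J'
    using finite_subset[OF that fin(1)] that
  proof (induction J' rule: finite_induct)
    case empty
    then show ?case by simp
  next
    case (insert j J')
    let ?q = "p ^ card (G j)" and ?Z = "Z G (K \<union> J')"
    have j: "j \<notin> K \<union> J'" "j \<in> J" using insert assms(5) by auto
    have "(\<Sum>i\<in>{i \<in> K \<union> J'. G i \<inter> G j \<noteq> {}}. p ^ card (G j \<union> G i)) \<le>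
        (\<Sum>i\<in>{i \<in> K \<union> J - {j}. G i \<inter> G j \<noteq> {}}. p ^ card (G j \<union> G i))"
      using insert.prems j fin p_pos by (intro sum_mono2) auto
    also have "\<dots> \<le> v j" using j v by blast
    finally have "(?q - v j) * ?Z \<le> (?q - (\<Sum>i\<in>{i \<in> K \<union> J'. G i \<inter> G j \<noteq> {}}. p ^ card (G j \<union> G i))) * ?Z"
      by (intro mult_right_mono) auto
    also have "\<dots> \<le> avoid G (G j) (K \<union> J')"
      using insert fin sub j by (intro avoid_ge_intersecting) auto
    finally have "Z G (insert j (K \<union> J')) \<le> (1 + (v j - ?q)) * ?Z"
      by (simp add: avoid_insert algebra_simps)
    also have "\<dots> \<le> exp (v j - ?q) * ?Z"
      by (intro mult_right_mono exp_ge_add_one_self) simp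
    also have "\<dots> \<le> exp (v j - ?q) * (Z G K * exp (\<Sum>j\<in>J'. v j - p ^ card (G j)))"
      using insert by (intro mult_left_mono) auto
    finally show ?case
      using insert(1,2) by (simp add: exp_add mult_ac)
  qed
  then show ?thesis by blast
qed

end

context hypergraph_model
begin

lemma w2_eq: "i \<in> {1..N} \<Longrightarrow> j \<in> {1..N} \<Longrightarrow> w2 i j = p ^ s * p ^ card (E j - E i)"
  using card_Un_disjoint[of "E i" "E j - E i"]
  by (simp add: finite_edge card_edge flip: power_add)

lemma w3_eq:
  "i \<in> {1..N} \<Longrightarrow> j \<in> {1..N} \<Longrightarrow> k \<in> {1..N} \<Longrightarrow>
    w3 i j k = p ^ s * p ^ card (E j \<union> E k - E i)"
  using card_Un_disjoint[of "E i" "E j \<union> E k - E i"]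
  by (simp add: finite_edge card_edge Un_assoc flip: power_add)

lemma nb_sym: "i \<in> {1..N} \<Longrightarrow> j \<in> nb i \<Longrightarrow> i \<in> nb j"
  by (auto simp: nb_def adj_def)

lemma w2_ge: "i \<in> {1..N} \<Longrightarrow> j \<in> {1..N} \<Longrightarrow> (p ^ s)\<^sup>2 \<le> w2 i j"
  using pow_p_Un[of "E i" "E j"] by (simp add: card_edge power2_eq_square)

lemma sum_nb_swap:
  assumes "A \<subseteq> {1..N}" "B \<subseteq> {1..N}"
  shows "(\<Sum>i\<in>A. \<Sum>j\<in>B \<inter> nb i. h i j) = (\<Sum>j\<in>B. \<Sum>i\<in>A \<inter> nb j. h i j)"
proof -
  have "(\<Sum>i\<in>A. \<Sum>j\<in>B \<inter> nb i. h i j) = (\<Sum>i\<in>A. \<Sum>j | j \<in> B \<and> adj E i j. h i j)"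
    using assms by (intro sum.cong) (auto simp: nb_def)
  also have "\<dots> = (\<Sum>j\<in>B. \<Sum>i | i \<in> A \<and> adj E i j. h i j)"
    using assms finite_subset by (intro sum.swap_restrict) blast+
  also have "\<dots> = (\<Sum>j\<in>B. \<Sum>i\<in>A \<inter> nb j. h i j)"
    using assms by (intro sum.cong) (auto simp: nb_def adj_def)
  finally show ?thesis .
qed

end

context sparse_model
begin

text \<open>Telescoping of \<open>ln_Z_insert\<close>. An adjacent pair contributes once, when the
  later of its two indices is inserted, whence half of the ordered sum.\<close>

lemma ln_Z_bound:
  assumes "J \<subseteq> {1..N}"
  shows "\<bar>ln (Z E J) - real (card J) * ln (1 - pi_s) - 1 / 2 * (\<Sum>i\<in>J. \<Sum>j\<in>J \<inter> nb i. w2 i j - pi_s\<^sup>2)\<bar>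
    \<le> (4 + 2 / c) * (\<Sum>j\<in>J. bdeg j + cdeg j + f * adeg j + pi_s\<^sup>2)"
  using finite_subset[OF assms finite_atLeastAtMost] assms
proof (induction J rule: finite_induct)
  case (insert j K)
  let ?g = "\<lambda>i j. w2 i j - pi_s\<^sup>2"
  have "(\<Sum>i\<in>insert j K. \<Sum>k\<in>insert j K \<inter> nb i. ?g i k) =
      (\<Sum>k\<in>K \<inter> nb j. ?g j k) + (\<Sum>i\<in>K. (\<Sum>k\<in>K \<inter> nb i. ?g i k) + (\<Sum>k\<in>{j} \<inter> nb i. ?g i k))"
  proof -
    have "insert j K \<inter> nb j = K \<inter> nb j" using insert by (auto simp: nb_def)
    moreover have "{j} \<inter> nb j = {}" by (auto simp: nb_def)
    moreover have "(\<Sum>k\<in>insert j K \<inter> nb i. ?g i k) =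
        (\<Sum>k\<in>K \<inter> nb i. ?g i k) + (\<Sum>k\<in>{j} \<inter> nb i. ?g i k)" for i
    proof -
      have "insert j K \<inter> nb i = (K \<inter> nb i) \<union> ({j} \<inter> nb i)" by auto
      then show ?thesis using insert(1,2) by (simp only:) (intro sum.union_disjoint, auto)
    qed
    ultimately show ?thesis using insert(1,2) by (simp only: sum.insert[OF insert(1,2)] sum.empty add_0_right)
  qed
  also have "\<dots> = (\<Sum>i\<in>K. \<Sum>k\<in>K \<inter> nb i. ?g i k) + 2 * (\<Sum>k\<in>K \<inter> nb j. ?g j k)"
  proof -
    have "(\<Sum>i\<in>K. \<Sum>k\<in>{j} \<inter> nb i. ?g i k) = (\<Sum>i\<in>K \<inter> nb j. ?g i j)"
      using sum_nb_swap[of K "{j}" ?g] insert.prems by simp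
    then show ?thesis by (simp add: sum.distrib Un_commute)
  qed
  finally have eq1: "1 / 2 * (\<Sum>i\<in>insert j K. \<Sum>k\<in>insert j K \<inter> nb i. ?g i k) =
      1 / 2 * (\<Sum>i\<in>K. \<Sum>k\<in>K \<inter> nb i. ?g i k) + (\<Sum>k\<in>K \<inter> nb j. ?g j k)"
    by simp
  have eq2: "real (card (insert j K)) * ln (1 - pi_s) = real (card K) * ln (1 - pi_s) + ln (1 - pi_s)"
    using insert(1,2) by (simp add: algebra_simps)
  let ?u = "\<lambda>j. bdeg j + cdeg j + f * adeg j + pi_s\<^sup>2"
  have eq3: "(4 + 2 / c) * sum ?u (insert j K) = (4 + 2 / c) * sum ?u K + (4 + 2 / c) * ?u j"
    unfolding sum.insert[OF insert(1,2)] by (simp only: distrib_left add.commute)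
  have combine: "\<bar>z1 - (k + l) - (g0 + g)\<bar> \<le> m0 + m"
    if "\<bar>z0 - k - g0\<bar> \<le> m0" "\<bar>z1 - z0 - l - g\<bar> \<le> m" for z0 z1 k l g0 g m0 m :: real
    using that by linarith
  have sub: "K \<subseteq> {1..N}" "j \<in> {1..N}" using insert.prems by auto
  show ?case
    unfolding eq1 eq2 eq3 by (rule combine[OF insert.IH[OF sub(1)] ln_Z_insert[OF sub(2,1) insert(2)]])
qed simp

end

section \<open>Conditioning on the edges in Y\<close>

text \<open>\<open>not_covered\<close> reflects that Y is possible: an edge inside R(Y) would be
  forced into I. The three constancy assumptions are the form in which symmetry acts on sums over
  Y.\<close>

locale conditioned_model = sparse_model X p N E s c f
  for X :: "'a set" and p N E s c f +
  fixes Y :: "nat set" and L c' :: real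
  assumes Y_subset: "Y \<subseteq> {1..N}" and card_Y: "real (card Y) \<le> L * (p ^ s * real N)"
    and L_pos: "L > 0"
    and not_covered: "\<And>j. j \<in> {1..N} - Y \<Longrightarrow> \<not> E j \<subseteq> R E Y"
    and c'_pos: "c' > 0" and c'_le: "c' \<le> 1 - p"
    and adeg_const: "\<And>i j. i \<in> {1..N} \<Longrightarrow> j \<in> {1..N} \<Longrightarrow> adeg i = adeg j"
    and bdeg_const: "\<And>i j. i \<in> {1..N} \<Longrightarrow> j \<in> {1..N} \<Longrightarrow> bdeg i = bdeg j"
    and deg_const: "\<And>i j. i \<in> {1..N} \<Longrightarrow> j \<in> {1..N} \<Longrightarrow> card (nb i) = card (nb j)"
begin

definition G :: "nat \<Rightarrow> 'a set" where "G j = E j - R E Y"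
abbreviation q :: "nat \<Rightarrow> real" where "q j \<equiv> p ^ card (G j)"
abbreviation nY :: "nat \<Rightarrow> nat set" where "nY j \<equiv> Y \<inter> nb j"
definition J0 :: "nat set" where "J0 = {j \<in> {1..N} - Y. nY j = {}}"
definition J1 :: "nat set" where "J1 = {j \<in> {1..N} - Y. card (nY j) = 1}"
definition JC :: "nat set" where "JC = {j. complex_index N E Y j}"

text \<open>These will turn out to be 2 Delta_2, a quantity of at most 27 Delta_3, and 2
  Delta_2^0.\<close>

definition A\<^sub>N :: real where "A\<^sub>N = (\<Sum>i\<in>{1..N}. adeg i)"
definition B\<^sub>N :: real where "B\<^sub>N = (\<Sum>i\<in>{1..N}. bdeg i)"
definition D\<^sub>N :: real where "D\<^sub>N = (\<Sum>i\<in>{1..N}. real (card (nb i)) * pi_s\<^sup>2)"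

lemma finite_Y [simp]: "finite Y"
  using Y_subset finite_subset by blast

lemma pi_pos: "pi_s > 0" using p_pos by simp

lemma sum_Y_eq:
  assumes "\<And>i j. i \<in> {1..N} \<Longrightarrow> j \<in> {1..N} \<Longrightarrow> h i = (h j :: real)"
  shows "(\<Sum>y\<in>Y. h y) * real N = real (card Y) * (\<Sum>i\<in>{1..N}. h i)"
proof (cases "N = 0")
  case True
  then show ?thesis using Y_subset by simp
next
  case False
  then have h: "h i = h 1" if "i \<in> {1..N}" for i using assms[of i 1] that by auto
  then have "(\<Sum>y\<in>Y. h y) = (\<Sum>y\<in>Y. h 1)" "(\<Sum>i\<in>{1..N}. h i) = (\<Sum>i\<in>{1..N}. h 1)"
    using Y_subset by (intro sum.cong refl h; blast)+
  then show ?thesis by simp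
qed

text \<open>Here |Y| = O(mu) enters: a constant summand gives Y the share |Y|/N <= L pi of the full
  sum. The factor pi gained pays for the division by pi in every conditioning on an edge of
  Y.\<close>

lemma sum_Y_le:
  assumes "\<And>i j. i \<in> {1..N} \<Longrightarrow> j \<in> {1..N} \<Longrightarrow> h i = (h j :: real)"
    and nonneg: "\<And>i. h i \<ge> 0"
  shows "(\<Sum>y\<in>Y. h y) \<le> L * pi_s * (\<Sum>i\<in>{1..N}. h i)"
proof (cases "N = 0")
  case True
  then show ?thesis using Y_subset by simp
next
  case False
  have "(\<Sum>y\<in>Y. h y) * real N = real (card Y) * (\<Sum>i\<in>{1..N}. h i)"
    using assms(1) by (rule sum_Y_eq)
  also have "\<dots> \<le> (L * (pi_s * real N)) * (\<Sum>i\<in>{1..N}. h i)"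
    using card_Y nonneg by (intro mult_right_mono sum_nonneg) auto
  also have "\<dots> = (L * pi_s * (\<Sum>i\<in>{1..N}. h i)) * real N" by simp
  finally show ?thesis using False by simp
qed

lemma A\<^sub>N_nonneg: "A\<^sub>N \<ge> 0" and B\<^sub>N_nonneg: "B\<^sub>N \<ge> 0"
  using adeg_nonneg bdeg_nonneg by (auto simp: A\<^sub>N_def B\<^sub>N_def intro!: sum_nonneg)

lemma pi_A\<^sub>N: "pi_s * A\<^sub>N \<le> f * A\<^sub>N"
  using pi_adeg_le by (auto simp: A\<^sub>N_def sum_distrib_left intro!: sum_mono)

lemma sum_Y_adeg: "(\<Sum>y\<in>Y. adeg y) \<le> L * pi_s * A\<^sub>N"
  unfolding A\<^sub>N_def by (intro sum_Y_le adeg_const adeg_nonneg)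

lemma sum_Y_bdeg: "(\<Sum>y\<in>Y. bdeg y) \<le> L * pi_s * B\<^sub>N"
  unfolding B\<^sub>N_def by (intro sum_Y_le bdeg_const bdeg_nonneg)

lemma sum_nY_le:
  assumes "A \<subseteq> {1..N}" "\<And>y j. y \<in> Y \<Longrightarrow> j \<in> nb y \<Longrightarrow> h y j \<ge> (0::real)"
  shows "(\<Sum>j\<in>A. \<Sum>y\<in>nY j. h y j) \<le> (\<Sum>y\<in>Y. \<Sum>j\<in>nb y. h y j)"
  unfolding sum_nb_swap[OF assms(1) Y_subset, of "\<lambda>j y. h y j"]
  using assms(2) by (intro sum_mono sum_mono2) auto

lemma G_eq: "j \<in> {1..N} - Y \<Longrightarrow> G j = E j - (\<Union>y\<in>nY j. E y)"
proof -
  assume j: "j \<in> {1..N} - Y"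
  have "E j \<inter> R E Y = E j \<inter> (\<Union>y\<in>nY j. E y)"
  proof (intro equalityI subsetI)
    fix v assume v: "v \<in> E j \<inter> R E Y"
    then obtain y where y: "y \<in> Y" "v \<in> E y" by (auto simp: R_def)
    then have "y \<in> nb j" using v j Y_subset by (auto simp: nb_def adj_def)
    then show "v \<in> E j \<inter> (\<Union>y\<in>nY j. E y)" using v y by blast
  qed (auto simp: R_def)
  then show ?thesis unfolding G_def by blast
qed

lemma J1_nY:
  assumes "j \<in> J1" "y \<in> nY j"
  shows "nY j = {y}"
proof -
  have "card (nY j) = 1" using assms(1) by (simp add: J1_def)
  then obtain x where "nY j = {x}" by (rule card_1_singletonE)
  with assms(2) show ?thesis by (metis singletonD)
qed

lemma G_simps: "j \<in> J0 \<Longrightarrow> G j = E j" "j \<in> J1 \<Longrightarrow> y \<in> nY j \<Longrightarrow> G j = E j - E y"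
proof -
  show "j \<in> J0 \<Longrightarrow> G j = E j" using G_eq[of j] by (simp add: J0_def)
  show "G j = E j - E y" if j: "j \<in> J1" "y \<in> nY j"
  proof -
    have "j \<in> {1..N} - Y" using j(1) by (simp add: J1_def)
    then show ?thesis using G_eq[of j] unfolding J1_nY[OF j] by simp
  qed
qed

lemma J1_sum:
  assumes "j \<in> J1" "y \<in> nY j"
  shows "(\<Sum>y\<in>nY j. h y) = h y"
  unfolding J1_nY[OF assms] by simp

lemma J1_ex:
  assumes "j \<in> J1"
  obtains y where "y \<in> nY j"
proof -
  have "card (nY j) = 1" using assms by (simp add: J1_def)
  then show thesis using that by (metis card_1_singletonE insertI1)
qed

lemma partition: "{1..N} - Y = J0 \<union> (J1 \<union> JC)" "J0 \<inter> (J1 \<union> JC) = {}" "J1 \<inter> JC = {}" "J0 \<inter> J1 = {}"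
proof -
  have *: "{i \<in> Y. adj E i j} = nY j" if "j \<in> {1..N}" for j
    using that Y_subset by (auto simp: nb_def adj_def)
  then have JC: "JC = {j \<in> {1..N} - Y. card (nY j) \<ge> 2}"
    unfolding JC_def complex_index_def by (intro Collect_cong) auto
  have "card (nY j) = 0 \<longleftrightarrow> nY j = {}" for j by simp
  then have J0: "J0 = {j \<in> {1..N} - Y. card (nY j) = 0}" by (auto simp: J0_def)
  show "{1..N} - Y = J0 \<union> (J1 \<union> JC)"
    unfolding J0 J1_def JC by (auto simp del: card_0_eq card_eq_0_iff)
  show "J0 \<inter> (J1 \<union> JC) = {}" "J1 \<inter> JC = {}" "J0 \<inter> J1 = {}"
    unfolding J0 J1_def JC by auto
qed

lemma J_subset: "J0 \<subseteq> {1..N}" "J1 \<subseteq> {1..N}" "JC \<subseteq> {1..N}"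
  using partition(1) by blast+

lemma finite_J [simp]: "finite J0" "finite J1" "finite JC"
  using J_subset by (auto intro: finite_subset[OF _ finite_atLeastAtMost])

lemma G_subset: "j \<in> {1..N} \<Longrightarrow> G j \<subseteq> X"
  using edge_subset by (auto simp: G_def)

text \<open>Every trace keeps at least one vertex, so its probability is at most p. This is how 1 -
  p = Omega(1) keeps the logarithms of 1 - q j under control.\<close>

lemma q_le: "j \<in> {1..N} - Y \<Longrightarrow> q j \<le> 1 - c'"
proof -
  assume j: "j \<in> {1..N} - Y"
  then have "G j \<noteq> {}" "finite (G j)" using not_covered finite_edge by (auto simp: G_def)
  then have "card (G j) \<ge> 1" by (simp add: Suc_le_eq card_gt_0_iff)
  then have "q j \<le> p ^ 1" by (rule pow_p_mono)
  then show ?thesis using c'_le by simp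
qed

lemma pi_le_q: "j \<in> {1..N} \<Longrightarrow> pi_s \<le> q j"
  using card_mono[of "E j" "G j"] by (intro pow_p_mono) (auto simp: G_def finite_edge card_edge)

end

section \<open>Error terms caused by simple and complex indices\<close>

context binomial_model
begin

lemma cond_prob_superset:
  assumes "A \<subseteq> X" "B \<subseteq> X"
  shows "\<P>(W in binomial_subset X p. A \<subseteq> W \<bar> B \<subseteq> W) = p ^ card (A - B)"
proof -
  have fin: "finite A" "finite B" using assms finite_X finite_subset by blast+
  have "card (A \<union> B) = card (A - B) + card B"
    using card_Un_disjoint[of "A - B" B] fin by (simp add: Diff_Int_distrib2)
  moreover have "{W. A \<subseteq> W \<and> B \<subseteq> W} = {W. A \<union> B \<subseteq> W}" by auto
  ultimately show ?thesis
    using pr_superset_only[of "A \<union> B"] pr_superset_only[of B] assms p_pos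
    by (simp add: cond_prob_def power_add)
qed

end

context hypergraph_model
begin

lemma cluster3I:
  assumes "{i, j, k} \<subseteq> {1..N}" "distinct [i, j, k]" "adj E i j" "adj E j k"
  shows "cluster N E 3 {i, j, k}"
proof -
  let ?r = "{(a, b). a \<in> {i, j, k} \<and> b \<in> {i, j, k} \<and> adj E a b}"
  have e: "(i, j) \<in> ?r" "(j, i) \<in> ?r" "(j, k) \<in> ?r" "(k, j) \<in> ?r"
    using assms adj_sym by auto
  then have "(i, k) \<in> ?r\<^sup>*" "(k, i) \<in> ?r\<^sup>*"
    by (meson r_into_rtrancl rtrancl_trans)+
  with e have "\<forall>a\<in>{i, j, k}. \<forall>b\<in>{i, j, k}. (a, b) \<in> ?r\<^sup>*"
    by (auto intro: r_into_rtrancl)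
  then show ?thesis using assms by (simp add: cluster_def)
qed

end

context conditioned_model
begin

text \<open>
  Two intersecting traces of simple indices with different neighbours in \<open>Y\<close> span a path
  \<open>i \<sim> i' \<sim> j' \<sim> j\<close> as in \<open>Q\<^sub>4\<close>; the other intersecting pairs extend to a 3-cluster
  through the neighbour in \<open>Y\<close>.
\<close>
definition far :: "nat \<Rightarrow> nat set" where
  "far j = {k \<in> J1. k \<in> nb j \<and> nY k \<inter> nY j = {} \<and> G k \<inter> G j \<noteq> {}}"

text \<open>The quotient \<open>w3 y j k / pi_s\<close> is P(A_j and A_k | A_y). For a simple j the
  sum over \<open>nY j\<close> has one term; writing it as a sum allows the exchange of j and y in
  \<open>sum_nY_le\<close>.\<close>

definition v :: "nat \<Rightarrow> real" where
  "v j = (\<Sum>y\<in>nY j. \<Sum>k\<in>nb j - {y}. w3 y j k / pi_s) + (\<Sum>k\<in>far j. p ^ card (G j \<union> G k))"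

lemma J1_mem: "j \<in> J1 \<Longrightarrow> j \<in> {1..N} - Y" and J0_mem: "j \<in> J0 \<Longrightarrow> j \<in> {1..N} - Y"
  by (auto simp: J0_def J1_def)

lemma v_ge:
  assumes j: "j \<in> J1"
  shows "(\<Sum>i\<in>{i \<in> J0 \<union> J1 - {j}. G i \<inter> G j \<noteq> {}}. p ^ card (G j \<union> G i)) \<le> v j"
proof -
  define S where "S = {i \<in> J0 \<union> J1 - {j}. G i \<inter> G j \<noteq> {}}"
  obtain y where y: "y \<in> nY j" using J1_ex[OF j] .
  have jN: "j \<in> {1..N} - Y" using j by (rule J1_mem)
  have yN: "y \<in> {1..N}" "y \<in> Y" using y Y_subset by auto
  have SN: "i \<in> {1..N} - Y" "i \<in> nb j" if "i \<in> S" for i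
    using that J0_mem J1_mem by (auto simp: S_def nb_def adj_def G_def)
  have finS: "finite S" by (simp add: S_def)
  have Gj: "G j = E j - E y" using G_simps(2)[OF j y] .
  \<comment> \<open>Off \<open>far j\<close>, both traces are obtained by removing the same
    \<open>E y\<close>: an isolated i is disjoint from \<open>E y\<close>, and a simple i shares its
    only neighbour in Y with j.\<close>
  have near: "p ^ card (G j \<union> G i) = w3 y j i / pi_s" if i: "i \<in> S - far j" for i
  proof -
    have "G i = E i - E y"
    proof (cases "i \<in> J0")
      case True
      then have "E i \<inter> E y = {}"
        using yN SN[of i] i by (auto simp: J0_def nb_def adj_def)
      then show ?thesis using G_simps(1)[OF True] by blast
    next
      case False
      then have iJ: "i \<in> J1" using i by (auto simp: S_def)
      then have "nY i \<inter> nY j \<noteq> {}" using i SN[of i] by (auto simp: far_def S_def)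
      then have "y \<in> nY i" using J1_nY[OF j y] by auto
      then show ?thesis using G_simps(2)[OF iJ] by blast
    qed
    then have "G j \<union> G i = E j \<union> E i - E y" using Gj by blast
    then show ?thesis
      using w3_eq[of y j i] yN jN SN[of i] i p_pos by simp
  qed
  have "(\<Sum>i\<in>S. p ^ card (G j \<union> G i)) =
      (\<Sum>i\<in>S - far j. p ^ card (G j \<union> G i)) + (\<Sum>i\<in>S \<inter> far j. p ^ card (G j \<union> G i))"
    using finS by (metis add.commute sum.Int_Diff)
  also have "(\<Sum>i\<in>S - far j. p ^ card (G j \<union> G i)) = (\<Sum>i\<in>S - far j. w3 y j i / pi_s)"
    by (rule sum.cong[OF refl near])
  also have "\<dots> \<le> (\<Sum>k\<in>nb j - {y}. w3 y j k / pi_s)"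
    using SN yN by (intro sum_mono2) auto
  also have "\<dots> = (\<Sum>y\<in>nY j. \<Sum>k\<in>nb j - {y}. w3 y j k / pi_s)"
    using J1_sum[OF j y, of "\<lambda>y. \<Sum>k\<in>nb j - {y}. w3 y j k / pi_s"] by simp
  also have "(\<Sum>i\<in>S \<inter> far j. p ^ card (G j \<union> G i)) \<le> (\<Sum>k\<in>far j. p ^ card (G j \<union> G k))"
    by (intro sum_mono2) (auto simp: far_def)
  finally show ?thesis by (simp add: v_def S_def)
qed

definition Q4s :: real where "Q4s = (\<Sum>j\<in>J1. \<Sum>k\<in>far j. p ^ card (G j \<union> G k))"
definition Q3s :: real where "Q3s = (\<Sum>j\<in>JC. \<Sum>y\<in>nY j. p ^ card (E j - E y))"

lemma sum_v_le: "(\<Sum>j\<in>J1. v j) \<le> L * B\<^sub>N + Q4s"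
proof -
  have "(\<Sum>j\<in>J1. \<Sum>y\<in>nY j. \<Sum>k\<in>nb j - {y}. w3 y j k / pi_s) \<le>
      (\<Sum>y\<in>Y. \<Sum>j\<in>nb y. \<Sum>k\<in>nb j - {y}. w3 y j k / pi_s)"
    using J_subset(2) by (intro sum_nY_le) (auto intro!: sum_nonneg)
  also have "\<dots> = (\<Sum>y\<in>Y. bdeg y) / pi_s"
    by (simp add: bdeg_def sum_divide_distrib)
  also have "\<dots> \<le> L * pi_s * B\<^sub>N / pi_s"
    using sum_Y_bdeg pi_pos by (intro divide_right_mono) auto
  also have "\<dots> = L * B\<^sub>N" using p_pos by simp
  finally show ?thesis by (simp add: v_def sum.distrib Q4s_def)
qed

text \<open>The pair (j, k) is sent to the path (yy j, j, k, yy k), where \<open>yy\<close> gives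
  the unique neighbour in Y. The map is injective because j and k can be read off. The weights agree
  because j misses \<open>E (yy k)\<close> and k misses \<open>E (yy j)\<close>.\<close>

lemma Q4s_le: "Q4s \<le> Q4 X N E p Y"
proof -
  define yy where "yy j = (SOME y. y \<in> nY j)" for j
  have yy: "yy j \<in> nY j" if "j \<in> J1" for j
    using J1_ex[OF that] unfolding yy_def by (metis someI_ex)
  let ?T = "{(i, i', j', j). i \<in> Y \<and> j \<in> Y \<and> i' \<in> {1..N} \<and> j' \<in> {1..N} \<and>
              distinct [i, i', j', j] \<and> adj E i i' \<and> adj E i' j' \<and> adj E j' j \<and>
              \<not> adj E i' j \<and> \<not> adj E i j'}"
  let ?P = "\<lambda>(i, i', j', j). \<P>(W in binomial_subset X p. E i' \<subseteq> W \<and> E j' \<subseteq> W \<bar> E i \<subseteq> W \<and> E j \<subseteq> W)"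
  let ?m = "\<lambda>(j, k). (yy j, j, k, yy k)"
  have fin_far: "finite (far j)" for j by (simp add: far_def)
  have props: "j \<in> {1..N} - Y" "k \<in> {1..N} - Y" "yy j \<in> Y" "yy k \<in> Y" "yy j \<noteq> yy k" "j \<noteq> k"
      "adj E (yy j) j" "adj E j k" "adj E k (yy k)" "\<not> adj E j (yy k)" "\<not> adj E (yy j) k"
      "G j \<union> G k = (E j \<union> E k) - (E (yy j) \<union> E (yy k))"
    if jk: "j \<in> J1" "k \<in> far j" for j k
  proof -
    have k: "k \<in> J1" "k \<in> nb j" "nY k \<inter> nY j = {}" using jk by (auto simp: far_def)
    show m: "j \<in> {1..N} - Y" "k \<in> {1..N} - Y" "yy j \<in> Y" "yy k \<in> Y"
      using jk k J1_mem yy by blast+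
    show "yy j \<noteq> yy k" using yy[OF jk(1)] yy[OF k(1)] k(3) by auto
    show "adj E j k" using k(2) by (simp add: nb_def)
    then show "j \<noteq> k" by (auto simp: adj_def)
    show "adj E (yy j) j" using yy[OF jk(1)] by (simp add: nb_def adj_sym)
    show "adj E k (yy k)" using yy[OF k(1)] by (simp add: nb_def)
    have nj: "yy k \<notin> nY j" and nk: "yy j \<notin> nY k"
      using yy[OF jk(1)] yy[OF k(1)] k(3) by auto
    show a1: "\<not> adj E j (yy k)" using nj m Y_subset by (auto simp: nb_def)
    have a2: "\<not> adj E k (yy j)" using nk m Y_subset by (auto simp: nb_def)
    then show "\<not> adj E (yy j) k" by (simp add: adj_sym)
    have "E j \<inter> E (yy k) = {}" "E k \<inter> E (yy j) = {}"
      using a1 a2 m by (auto simp: adj_def)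
    then show "G j \<union> G k = (E j \<union> E k) - (E (yy j) \<union> E (yy k))"
      using G_simps(2)[OF jk(1) yy[OF jk(1)]] G_simps(2)[OF k(1) yy[OF k(1)]] by blast
  qed
  have "Q4s = (\<Sum>(j, k)\<in>Sigma J1 far. p ^ card (G j \<union> G k))"
    unfolding Q4s_def using fin_far by (simp add: sum.Sigma)
  also have "\<dots> = (\<Sum>z\<in>Sigma J1 far. ?P (?m z))"
  proof (intro sum.cong refl)
    fix z assume "z \<in> Sigma J1 far"
    then obtain j k where z: "z = (j, k)" "j \<in> J1" "k \<in> far j" by auto
    have "?P (?m z) = \<P>(W in binomial_subset X p. E j \<union> E k \<subseteq> W \<bar> E (yy j) \<union> E (yy k) \<subseteq> W)"
      by (simp add: z)
    also have "\<dots> = p ^ card (G j \<union> G k)"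
    proof -
      have "{j, k, yy j, yy k} \<subseteq> {1..N}" using props[OF z(2,3)] Y_subset by blast
      then have "E j \<union> E k \<subseteq> X" "E (yy j) \<union> E (yy k) \<subseteq> X"
        using edge_subset by (simp_all del: atLeastAtMost_iff)
      then show ?thesis
        unfolding props(12)[OF z(2,3)] by (rule cond_prob_superset)
    qed
    finally show "(case z of (j, k) \<Rightarrow> p ^ card (G j \<union> G k)) = ?P (?m z)" by (simp add: z)
  qed
  also have "\<dots> = (\<Sum>z\<in>?m ` Sigma J1 far. ?P z)"
    by (subst sum.reindex) (auto intro!: inj_onI)
  also have "\<dots> \<le> (\<Sum>z\<in>?T. ?P z)"
  proof (rule sum_mono2)
    have "?T \<subseteq> Y \<times> {1..N} \<times> {1..N} \<times> Y" by auto
    then show "finite ?T" by (rule finite_subset) simp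
    show "?m ` Sigma J1 far \<subseteq> ?T"
    proof
      fix z assume "z \<in> ?m ` Sigma J1 far"
      then obtain j k where z: "z = (yy j, j, k, yy k)" and jk: "j \<in> J1" "k \<in> far j" by auto
      note pr = props[OF jk]
      have "yy j \<noteq> j" "yy j \<noteq> k" "j \<noteq> yy k" "k \<noteq> yy k"
        using pr(1-4) by (metis DiffD2)+
      with pr show "z \<in> ?T" by (simp add: z)
    qed
  qed (auto simp: cond_prob_def)
  also have "\<dots> = Q4 X N E p Y" by (simp add: Q4_def)
  finally show ?thesis .
qed

lemma nY_eq: "j \<in> {1..N} \<Longrightarrow> {i \<in> Y. adj E i j} = nY j"
  using Y_subset by (auto simp: nb_def adj_def)

text \<open>A complex j adjacent to y has a second neighbour z in Y, and y ~ j ~ z is a 3-cluster.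
  The triple (y, z, j) determines (j, y), so nothing is counted twice.\<close>

lemma Q3s_le: "Q3s \<le> Q3 X N E p Y"
proof -
  define zz where "zz j y = (SOME z. z \<in> nY j \<and> z \<noteq> y)" for j y
  have JC: "j \<in> {1..N} - Y" "card (nY j) \<ge> 2" if "j \<in> JC" for j
    using that nY_eq[of j] by (auto simp: JC_def complex_index_def)
  have zz: "zz j y \<in> nY j \<and> zz j y \<noteq> y" if "j \<in> JC" for j y
  proof -
    have "\<not> nY j \<subseteq> {y}" using JC(2)[OF that] card_mono[of "{y}" "nY j"] by auto
    then have "\<exists>z. z \<in> nY j \<and> z \<noteq> y" by blast
    then show ?thesis unfolding zz_def by (rule someI_ex)
  qed
  let ?T = "{(i, j, k). i \<in> Y \<and> j \<in> Y \<and> k \<in> {1..N} \<and> distinct [i, j, k] \<and> cluster N E 3 {i, j, k}}"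
  let ?P = "\<lambda>(i, j, k). \<P>(W in binomial_subset X p. E k \<subseteq> W \<bar> E i \<subseteq> W)"
  let ?m = "\<lambda>(j, y). (y, zz j y, j)"
  have "Q3s = (\<Sum>(j, y)\<in>Sigma JC nY. p ^ card (E j - E y))"
    unfolding Q3s_def by (simp add: sum.Sigma)
  also have "\<dots> = (\<Sum>z\<in>Sigma JC nY. ?P (?m z))"
  proof (intro sum.cong refl)
    fix z assume "z \<in> Sigma JC nY"
    then obtain j y where z: "z = (j, y)" "j \<in> {1..N}" "y \<in> {1..N}"
      using JC(1) Y_subset by blast
    show "(case z of (j, y) \<Rightarrow> p ^ card (E j - E y)) = ?P (?m z)"
      using cond_prob_superset[OF edge_subset edge_subset, OF z(2,3)] by (simp add: z(1))
  qed
  also have "\<dots> = (\<Sum>z\<in>?m ` Sigma JC nY. ?P z)"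
    by (subst sum.reindex) (auto intro!: inj_onI)
  also have "\<dots> \<le> (\<Sum>z\<in>?T. ?P z)"
  proof (rule sum_mono2)
    have "?T \<subseteq> Y \<times> Y \<times> {1..N}" by auto
    then show "finite ?T" by (rule finite_subset) simp
    show "?m ` Sigma JC nY \<subseteq> ?T"
    proof
      fix z assume "z \<in> ?m ` Sigma JC nY"
      then obtain j y where z: "z = (y, zz j y, j)" and jy: "j \<in> JC" "y \<in> nY j" by auto
      have "cluster N E 3 {y, j, zz j y}"
        using zz[OF jy(1), of y] JC(1)[OF jy(1)] jy(2) Y_subset
        by (intro cluster3I) (auto simp: nb_def adj_def)
      then have "cluster N E 3 {y, zz j y, j}" by (simp add: insert_commute)
      then show "z \<in> ?T"
        using zz[OF jy(1), of y] JC(1)[OF jy(1)] jy(2) by (auto simp: z)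
    qed
  qed (auto simp: cond_prob_def)
  also have "\<dots> = Q3 X N E p Y" by (simp add: Q3_def)
  finally show ?thesis .
qed

lemma Q2_eq: "2 * Q2 E Y = (\<Sum>y\<in>Y. real (card (nY y)))"
proof -
  have "{(i, j). i \<in> Y \<and> j \<in> Y \<and> adj E i j} = Sigma Y nY"
    using Y_subset by (auto simp: nb_def)
  then show ?thesis by (simp add: Q2_def)
qed

lemma JC_mem: "j \<in> JC \<Longrightarrow> j \<in> {1..N} - Y"
  by (simp add: JC_def complex_index_def)

lemma complex_sum_eq: "complex_sum N E p Y = (\<Sum>j\<in>JC. q j)"
  by (simp add: complex_sum_def JC_def G_def)

lemma q_eq: "j \<in> J1 \<Longrightarrow> q j = (\<Sum>y\<in>nY j. p ^ card (E j - E y))"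
  using J1_ex[of j] G_simps(2)[of j] J1_sum[of j] by metis

lemma adeg_div: "y \<in> {1..N} \<Longrightarrow> adeg y / pi_s = (\<Sum>j\<in>nb y. p ^ card (E j - E y))"
  unfolding adeg_def sum_divide_distrib
  using p_pos w2_eq[of y] nb_subset[of y] by (intro sum.cong) auto

lemma sum_q_le: "(\<Sum>j\<in>J1. q j) \<le> L * A\<^sub>N"
proof -
  have "(\<Sum>j\<in>J1. q j) = (\<Sum>j\<in>J1. \<Sum>y\<in>nY j. p ^ card (E j - E y))"
    by (intro sum.cong refl q_eq)
  also have "\<dots> \<le> (\<Sum>y\<in>Y. \<Sum>j\<in>nb y. p ^ card (E j - E y))"
    using J_subset(2) by (intro sum_nY_le) auto
  also have "\<dots> = (\<Sum>y\<in>Y. adeg y / pi_s)"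
    using adeg_div Y_subset by (intro sum.cong) auto
  also have "\<dots> = (\<Sum>y\<in>Y. adeg y) / pi_s" by (simp add: sum_divide_distrib)
  also have "\<dots> \<le> L * pi_s * A\<^sub>N / pi_s"
    using sum_Y_adeg pi_pos by (intro divide_right_mono) auto
  finally show ?thesis using p_pos by simp
qed

lemma q_le_f: assumes "j \<in> J1" shows "q j \<le> f"
proof -
  obtain y where y: "y \<in> nY j" using J1_ex[OF assms] .
  then have "p ^ card (E j - E y) \<le> f"
    using J1_mem[OF assms] Y_subset by (intro f_ge) (auto simp: nb_def adj_def)
  then show ?thesis using G_simps(2)[OF assms y] by simp
qed

lemma sum_q2_le: "(\<Sum>j\<in>J1. (q j)\<^sup>2) \<le> L * (f * A\<^sub>N)"
proof -
  have "(\<Sum>j\<in>J1. (q j)\<^sup>2) \<le> (\<Sum>j\<in>J1. f * q j)"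
    unfolding power2_eq_square by (intro sum_mono mult_right_mono q_le_f) auto
  also have "\<dots> = f * (\<Sum>j\<in>J1. q j)" by (simp add: sum_distrib_left)
  also have "\<dots> \<le> f * (L * A\<^sub>N)" using sum_q_le f_nonneg by (rule mult_left_mono)
  finally show ?thesis by (simp add: mult_ac)
qed

text \<open>The sum of P(A_j | A_y) - pi over y in Y and j ~ y is known exactly, by regularity. The
  neighbours of y are simple, complex or in Y. The simple ones give the sum of q j - pi, since each
  has just one y. The others make up \<open>rest\<close>, a sum of nonnegative terms charged to Q_3
  and phi Q_2.\<close>

lemma first_order:
  defines "rest \<equiv> real (card Y) * (A\<^sub>N - D\<^sub>N) / (pi_s * real N)
      - ((\<Sum>j\<in>J1. q j) - real (card J1) * pi_s)"
  shows "0 \<le> rest" "rest \<le> Q3s + f * (2 * Q2 E Y)"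
proof -
  let ?h = "\<lambda>y j. p ^ card (E j - E y) - pi_s"
  have h0: "?h y j \<ge> 0" if "j \<in> {1..N}" for y j
    using card_mono[of "E j" "E j - E y"] that
    by (simp add: pow_p_mono finite_edge flip: card_edge[OF that])
  have total: "(\<Sum>y\<in>Y. \<Sum>j\<in>nb y. ?h y j) = real (card Y) * (A\<^sub>N - D\<^sub>N) / (pi_s * real N)"
  proof (cases "N = 0")
    case False
    have "(\<Sum>y\<in>Y. \<Sum>j\<in>nb y. ?h y j) = (\<Sum>y\<in>Y. adeg y / pi_s - real (card (nb y)) * pi_s)"
      using adeg_div Y_subset by (intro sum.cong) (auto simp: sum_subtractf)
    also have "\<dots> * real N = real (card Y) * (\<Sum>i\<in>{1..N}. adeg i / pi_s - real (card (nb i)) * pi_s)"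
      using adeg_const deg_const by (intro sum_Y_eq) metis
    also have "(\<Sum>i\<in>{1..N}. adeg i / pi_s - real (card (nb i)) * pi_s) = (A\<^sub>N - D\<^sub>N) / pi_s"
      using p_pos by (simp add: A\<^sub>N_def D\<^sub>N_def sum_subtractf sum_divide_distrib diff_divide_distrib power2_eq_square)
    finally show ?thesis using False p_pos by (simp add: field_simps)
  qed (use Y_subset in simp)
  have split: "(\<Sum>y\<in>Y. \<Sum>j\<in>nb y. ?h y j) = (\<Sum>y\<in>Y. \<Sum>j\<in>J1 \<inter> nb y. ?h y j) +
      ((\<Sum>y\<in>Y. \<Sum>j\<in>JC \<inter> nb y. ?h y j) + (\<Sum>y\<in>Y. \<Sum>j\<in>nY y. ?h y j))"
    unfolding sum.distrib[symmetric]
  proof (intro sum.cong refl)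
    fix y assume y: "y \<in> Y"
    have "y \<in> {1..N}" using y Y_subset by blast
    then have "J0 \<inter> nb y = {}" using y nb_sym[of y] by (auto simp: J0_def)
    then have eq: "nb y = (J1 \<inter> nb y) \<union> ((JC \<inter> nb y) \<union> nY y)"
      using partition(1) nb_subset[of y] by blast
    have "(J1 \<inter> nb y) \<inter> ((JC \<inter> nb y) \<union> nY y) = {}" "(JC \<inter> nb y) \<inter> nY y = {}"
      using partition(3) J1_mem JC_mem by blast+
    then have "sum (?h y) ((J1 \<inter> nb y) \<union> ((JC \<inter> nb y) \<union> nY y)) =
       sum (?h y) (J1 \<inter> nb y) + (sum (?h y) (JC \<inter> nb y) + sum (?h y) (nY y))"
      by (subst sum.union_disjoint; simp)+
    then show "sum (?h y) (nb y) =
       sum (?h y) (J1 \<inter> nb y) + (sum (?h y) (JC \<inter> nb y) + sum (?h y) (nY y))"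
      using eq by simp
  qed
  have "(\<Sum>y\<in>Y. \<Sum>j\<in>J1 \<inter> nb y. ?h y j) = (\<Sum>j\<in>J1. \<Sum>y\<in>nY j. ?h y j)"
    by (rule sum_nb_swap[OF Y_subset J_subset(2)])
  also have "\<dots> = (\<Sum>j\<in>J1. q j - pi_s)"
  proof (intro sum.cong refl)
    fix j assume j: "j \<in> J1"
    have "(\<Sum>y\<in>nY j. ?h y j) = (\<Sum>y\<in>nY j. p ^ card (E j - E y)) - real (card (nY j)) * pi_s"
      by (simp add: sum_subtractf)
    then show "(\<Sum>y\<in>nY j. ?h y j) = q j - pi_s" using j q_eq[OF j] by (simp add: J1_def)
  qed
  finally have simple: "(\<Sum>y\<in>Y. \<Sum>j\<in>J1 \<inter> nb y. ?h y j) = (\<Sum>j\<in>J1. q j) - real (card J1) * pi_s"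
    by (simp add: sum_subtractf)
  have rest: "rest = (\<Sum>y\<in>Y. \<Sum>j\<in>JC \<inter> nb y. ?h y j) + (\<Sum>y\<in>Y. \<Sum>j\<in>nY y. ?h y j)"
    using split unfolding simple total rest_def by linarith
  have nn: "(\<Sum>y\<in>Y. \<Sum>j\<in>JC \<inter> nb y. ?h y j) \<ge> 0" "(\<Sum>y\<in>Y. \<Sum>j\<in>nY y. ?h y j) \<ge> 0"
    using nb_subset by (blast intro!: sum_nonneg h0)+
  then show "0 \<le> rest" unfolding rest by simp
  have "(\<Sum>y\<in>Y. \<Sum>j\<in>JC \<inter> nb y. ?h y j) \<le> (\<Sum>y\<in>Y. \<Sum>j\<in>JC \<inter> nb y. p ^ card (E j - E y))"
    using p_pos by (intro sum_mono) simp
  also have "\<dots> = Q3s"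
    unfolding Q3s_def using J_subset(3) by (intro sum_nb_swap Y_subset)
  finally have 1: "(\<Sum>y\<in>Y. \<Sum>j\<in>JC \<inter> nb y. ?h y j) \<le> Q3s" .
  have "(\<Sum>y\<in>Y. \<Sum>j\<in>nY y. ?h y j) \<le> (\<Sum>y\<in>Y. \<Sum>j\<in>nY y. f)"
  proof (intro sum_mono)
    fix y j assume "y \<in> Y" "j \<in> nY y"
    then have "p ^ card (E j - E y) \<le> f" using Y_subset by (intro f_ge) (auto simp: nb_def)
    then show "?h y j \<le> f" using pi_pos by simp
  qed
  also have "\<dots> = f * (2 * Q2 E Y)"
    unfolding Q2_eq by (simp add: sum_distrib_left mult.commute)
  finally show "rest \<le> Q3s + f * (2 * Q2 E Y)" using 1 unfolding rest by simp
qed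

abbreviation pairs :: "nat set \<Rightarrow> nat set \<Rightarrow> real" where
  "pairs A B \<equiv> (\<Sum>i\<in>A. \<Sum>j\<in>B \<inter> nb i. w2 i j - pi_s\<^sup>2)"

text \<open>If i has a neighbour y in Y, then P(A_i and A_j) <= P(A_i and A_j | A_y) for j other
  than y, so these pairs become paths starting in Y. The pairs {i, y}, and the indices of Y
  themselves, each cost one sum of \<open>adeg\<close> over Y, which explains 2 L.\<close>

lemma sum_adeg_le: "(\<Sum>i\<in>{1..N} - J0. adeg i) \<le> 2 * L * (f * A\<^sub>N) + L * B\<^sub>N"
proof -
  let ?M = "{1..N} - J0 - Y"
  have "adeg i \<le> (\<Sum>y\<in>nY i. w2 i y) + (\<Sum>y\<in>nY i. \<Sum>j\<in>nb i - {y}. w3 y i j / pi_s)"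
    if i: "i \<in> ?M" for i
  proof -
    obtain y where y: "y \<in> nY i" using i by (auto simp: J0_def)
    then have yN: "y \<in> {1..N}" using Y_subset by blast
    have iN: "i \<in> {1..N}" using i by simp
    have "adeg i = w2 i y + (\<Sum>j\<in>nb i - {y}. w2 i j)"
      unfolding adeg_def using y by (intro sum.remove) auto
    also have "(\<Sum>j\<in>nb i - {y}. w2 i j) \<le> (\<Sum>j\<in>nb i - {y}. w3 y i j / pi_s)"
    proof (intro sum_mono)
      fix j assume "j \<in> nb i - {y}"
      then have j: "j \<in> {1..N}" using nb_subset by blast
      have "finite (E i \<union> E j)" using finite_edge iN j by simp
      then have "w2 i j \<le> p ^ card (E i \<union> E j - E y)"
        by (intro pow_p_mono card_mono) auto
      then show "w2 i j \<le> w3 y i j / pi_s" using w3_eq[OF yN iN j] p_pos by simp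
    qed
    also have "\<dots> \<le> (\<Sum>y\<in>nY i. \<Sum>j\<in>nb i - {y}. w3 y i j / pi_s)"
      using y by (intro member_le_sum) (auto intro!: sum_nonneg)
    also have "w2 i y \<le> (\<Sum>y\<in>nY i. w2 i y)"
      using y by (intro member_le_sum) auto
    finally show ?thesis by simp
  qed
  then have "(\<Sum>i\<in>?M. adeg i) \<le> (\<Sum>i\<in>?M. \<Sum>y\<in>nY i. w2 i y) +
      (\<Sum>i\<in>?M. \<Sum>y\<in>nY i. \<Sum>j\<in>nb i - {y}. w3 y i j / pi_s)"
    unfolding sum.distrib[symmetric] by (rule sum_mono)
  also have "(\<Sum>i\<in>?M. \<Sum>y\<in>nY i. w2 i y) \<le> (\<Sum>y\<in>Y. \<Sum>i\<in>nb y. w2 i y)"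
    by (intro sum_nY_le) auto
  also have "\<dots> = (\<Sum>y\<in>Y. adeg y)" by (simp add: adeg_def Un_commute)
  also have "(\<Sum>i\<in>?M. \<Sum>y\<in>nY i. \<Sum>j\<in>nb i - {y}. w3 y i j / pi_s) \<le>
      (\<Sum>y\<in>Y. \<Sum>i\<in>nb y. \<Sum>j\<in>nb i - {y}. w3 y i j / pi_s)"
    by (intro sum_nY_le) (auto intro!: sum_nonneg)
  also have "\<dots> = (\<Sum>y\<in>Y. bdeg y) / pi_s" by (simp add: bdeg_def sum_divide_distrib)
  also have "\<dots> \<le> L * pi_s * B\<^sub>N / pi_s"
    using sum_Y_bdeg pi_pos by (intro divide_right_mono) auto
  also have "\<dots> = L * B\<^sub>N" using p_pos by simp
  finally have M: "(\<Sum>i\<in>?M. adeg i) \<le> (\<Sum>y\<in>Y. adeg y) + L * B\<^sub>N" by simp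
  have "{1..N} - J0 = ?M \<union> Y" using Y_subset J0_mem by blast
  moreover have "sum adeg (?M \<union> Y) = sum adeg ?M + sum adeg Y"
    by (rule sum.union_disjoint) auto
  ultimately have "(\<Sum>i\<in>{1..N} - J0. adeg i) = (\<Sum>i\<in>?M. adeg i) + (\<Sum>y\<in>Y. adeg y)"
    by (rule ssubst)
  also have "\<dots> \<le> 2 * (L * pi_s * A\<^sub>N) + L * B\<^sub>N" using M sum_Y_adeg by simp
  also have "L * pi_s * A\<^sub>N \<le> L * (f * A\<^sub>N)"
    using mult_left_mono[OF pi_A\<^sub>N, of L] L_pos by (simp add: mult.assoc)
  finally show ?thesis by simp
qed

text \<open>The difference consists of pairs with an end outside \<open>J0\<close>. Counted from
  such an end they form two sums, each at most the sum in \<open>sum_adeg_le\<close>; hence the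
  doubled constants.\<close>

lemma pairs_bounds:
  "pairs J0 J0 \<le> A\<^sub>N - D\<^sub>N" "A\<^sub>N - D\<^sub>N - pairs J0 J0 \<le> 4 * L * (f * A\<^sub>N) + 2 * L * B\<^sub>N"
proof -
  let ?V = "{1..N}" and ?g = "\<lambda>i j. w2 i j - pi_s\<^sup>2"
  let ?C = "?V - J0"
  have g0: "?g i j \<ge> 0" if "i \<in> ?V" "j \<in> ?V" for i j using w2_ge[OF that] by simp
  have total: "A\<^sub>N - D\<^sub>N = pairs ?V ?V"
  proof -
    have "?V \<inter> nb i = nb i" for i using nb_subset by blast
    then show ?thesis by (simp add: A\<^sub>N_def D\<^sub>N_def adeg_def sum_subtractf)
  qed
  have split1: "pairs ?V B = pairs J0 B + pairs ?C B" for B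
    using J_subset(1) by (metis (no_types, lifting) add.commute finite_atLeastAtMost sum.subset_diff)
  have split2: "pairs A ?V = pairs A J0 + pairs A ?C" for A
    unfolding sum.distrib[symmetric]
  proof (intro sum.cong refl)
    fix i
    have "?V \<inter> nb i = (J0 \<inter> nb i) \<union> (?C \<inter> nb i)" using J_subset(1) by blast
    then show "sum (?g i) (?V \<inter> nb i) = sum (?g i) (J0 \<inter> nb i) + sum (?g i) (?C \<inter> nb i)"
      by (simp only:) (intro sum.union_disjoint, auto)
  qed
  have "pairs J0 ?C = pairs ?C J0"
    using sum_nb_swap[OF J_subset(1), of ?C ?g] by (simp add: Un_commute)
  then have eq: "A\<^sub>N - D\<^sub>N - pairs J0 J0 = pairs ?C J0 + pairs ?C ?V"
    using total split1[of ?V] split2[of J0] by linarith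
  have nn: "pairs A B \<ge> 0" if "A \<subseteq> ?V" "B \<subseteq> ?V" for A B
    using that by (intro sum_nonneg g0) blast+
  show "pairs J0 J0 \<le> A\<^sub>N - D\<^sub>N"
    using eq nn[of ?C J0] nn[of ?C ?V] J_subset(1) by auto
  have "pairs ?C B \<le> (\<Sum>i\<in>?C. adeg i)" for B
  proof (intro sum_mono)
    fix i
    have "sum (?g i) (B \<inter> nb i) \<le> (\<Sum>j\<in>B \<inter> nb i. w2 i j)" by (intro sum_mono) simp
    also have "\<dots> \<le> adeg i" unfolding adeg_def by (intro sum_mono2) auto
    finally show "sum (?g i) (B \<inter> nb i) \<le> adeg i" .
  qed
  from this[of J0] this[of ?V] eq sum_adeg_le
  show "A\<^sub>N - D\<^sub>N - pairs J0 J0 \<le> 4 * L * (f * A\<^sub>N) + 2 * L * B\<^sub>N" by linarith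
qed

end

section \<open>Cluster sums and symmetry\<close>

context binomial_model
begin

lemma card_eq_sum_indicator:
  "finite A \<Longrightarrow> real (card {a \<in> A. P a}) = (\<Sum>a\<in>A. indicat_real {a. P a} a)"
proof -
  assume "finite A"
  moreover have "{a \<in> A. P a} = A \<inter> Collect P" by auto
  ultimately show ?thesis by (simp add: indicator_def)
qed

lemma expectation_card:
  assumes "finite A"
  shows "measure_pmf.expectation (binomial_subset X p) (\<lambda>W. real (card {a \<in> A. P a W})) = (\<Sum>a\<in>A. pr (P a))"
proof -
  have "measure_pmf.expectation (binomial_subset X p) (\<lambda>W. real (card {a \<in> A. P a W})) =
      measure_pmf.expectation (binomial_subset X p) (\<lambda>W. \<Sum>a\<in>A. indicat_real {W. P a W} W)"
    using assms by (simp add: card_eq_sum_indicator indicator_def)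
  also have "\<dots> = (\<Sum>a\<in>A. pr (P a))"
    by (subst Bochner_Integration.integral_sum)
      (auto intro!: measure_pmf.integrable_const_bound[where B = 1])
  finally show ?thesis .
qed

end

context hypergraph_model
begin

lemma finite_clusters: "finite {S. cluster N E k S}"
  by (rule finite_subset[of _ "Pow {1..N}"]) (auto simp: cluster_def)

lemma \<Delta>_eq: "\<Delta> X N E p k = (\<Sum>S\<in>{S. cluster N E k S}. p ^ card (R E S))"
proof -
  have "\<Delta> X N E p k = (\<Sum>S\<in>{S. cluster N E k S}. pr (\<lambda>W. S \<subseteq> contained_edges N E W))"
    unfolding \<Delta>_def using expectation_card[OF finite_clusters[of k], of "\<lambda>S W. S \<subseteq> contained_edges N E W"]
    by simp
  also have "\<dots> = (\<Sum>S\<in>{S. cluster N E k S}. p ^ card (R E S))"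
  proof (intro sum.cong refl)
    fix S assume "S \<in> {S. cluster N E k S}"
    then have S: "S \<subseteq> {1..N}" by (simp add: cluster_def)
    then have "(S \<subseteq> contained_edges N E W) = (R E S \<subseteq> W)" for W
      by (auto simp: contained_edges_def R_def)
    moreover have "R E S \<subseteq> X" using S edge_subset unfolding R_def by blast
    ultimately show "pr (\<lambda>W. S \<subseteq> contained_edges N E W) = p ^ card (R E S)"
      using pr_superset_only by simp
  qed
  finally show ?thesis .
qed

lemma \<Delta>_nonneg: "\<Delta> X N E p k \<ge> 0"
  unfolding \<Delta>_eq by (intro sum_nonneg) simp

lemma cluster2_iff: "cluster N E 2 S \<longleftrightarrow> (\<exists>i j. i \<in> {1..N} \<and> j \<in> {1..N} \<and> adj E i j \<and> S = {i, j})"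
proof
  assume S: "cluster N E 2 S"
  then obtain a b where ab: "S = {a, b}" "a \<noteq> b"
    unfolding cluster_def by (auto simp: card_2_iff)
  let ?r = "{(x, y). x \<in> S \<and> y \<in> S \<and> adj E x y}"
  have "(a, b) \<in> ?r\<^sup>*" using S ab by (auto simp: cluster_def)
  then obtain z where "(a, z) \<in> ?r"
    using ab(2) by (meson converse_rtranclE)
  then have "adj E a b" using ab by (auto simp: adj_def)
  then show "\<exists>i j. i \<in> {1..N} \<and> j \<in> {1..N} \<and> adj E i j \<and> S = {i, j}"
    using S ab by (auto simp: cluster_def)
next
  assume "\<exists>i j. i \<in> {1..N} \<and> j \<in> {1..N} \<and> adj E i j \<and> S = {i, j}"
  then obtain i j where ij: "i \<in> {1..N}" "j \<in> {1..N}" "adj E i j" and S: "S = {i, j}" by blast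
  let ?r = "{(x, y). x \<in> S \<and> y \<in> S \<and> adj E x y}"
  have "(i, j) \<in> ?r" "(j, i) \<in> ?r" using ij adj_sym by (auto simp: S)
  then have "\<forall>x\<in>S. \<forall>y\<in>S. (x, y) \<in> ?r\<^sup>*" unfolding S by blast
  moreover have "card S = 2" using ij(3) by (auto simp: S adj_def)
  ultimately show "cluster N E 2 S" using ij by (simp add: cluster_def S)
qed

lemma adeg_sum_eq: "(\<Sum>i\<in>{1..N}. adeg i) = 2 * \<Delta> X N E p 2"
proof -
  let ?P = "Sigma {1..N} nb" and ?m = "\<lambda>(i, j). {i, j} :: nat set"
  have "(\<Sum>i\<in>{1..N}. adeg i) = (\<Sum>z\<in>?P. p ^ card (R E (?m z)))"
    by (simp add: adeg_def sum.Sigma R_def split_def)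
  also have "\<dots> = (\<Sum>S\<in>{S. cluster N E 2 S}. \<Sum>z\<in>{z \<in> ?P. ?m z = S}. p ^ card (R E (?m z)))"
  proof (rule sum.group[symmetric])
    show "?m ` ?P \<subseteq> {S. cluster N E 2 S}"
      unfolding cluster2_iff by (fastforce simp: nb_def)
  qed (auto simp: finite_clusters)
  also have "\<dots> = (\<Sum>S\<in>{S. cluster N E 2 S}. 2 * p ^ card (R E S))"
  proof (intro sum.cong refl)
    fix S assume "S \<in> {S. cluster N E 2 S}"
    then obtain i j where ij: "i \<in> {1..N}" "j \<in> {1..N}" "adj E i j" and S: "S = {i, j}"
      by (auto simp: cluster2_iff)
    have "{z \<in> ?P. ?m z = S} = {(i, j), (j, i)}"
      using ij adj_sym by (auto simp: S nb_def doubleton_eq_iff)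
    moreover have "i \<noteq> j" using ij by (auto simp: adj_def)
    ultimately show "(\<Sum>z\<in>{z \<in> ?P. ?m z = S}. p ^ card (R E (?m z))) = 2 * p ^ card (R E S)"
      by (simp add: S insert_commute)
  qed
  finally show ?thesis by (simp add: \<Delta>_eq sum_distrib_left)
qed

text \<open>The indices of a path form a 3-cluster, and 27 = 3^3 crudely counts the triples with
  entries in a given cluster.\<close>

lemma bdeg_sum_le:
  "(\<Sum>i\<in>{1..N}. bdeg i) \<le> 27 * \<Delta> X N E p 3"
proof -
  let ?P = "Sigma {1..N} (\<lambda>i. Sigma (nb i) (\<lambda>j. nb j - {i}))" and ?m = "\<lambda>(i, j, k). {i, j, k} :: nat set"
  have "(\<Sum>i\<in>{1..N}. bdeg i) = (\<Sum>z\<in>?P. p ^ card (R E (?m z)))"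
    by (simp add: bdeg_def sum.Sigma R_def split_def Un_assoc)
  also have "\<dots> = (\<Sum>S\<in>{S. cluster N E 3 S}. \<Sum>z\<in>{z \<in> ?P. ?m z = S}. p ^ card (R E (?m z)))"
  proof (rule sum.group[symmetric])
    show "?m ` ?P \<subseteq> {S. cluster N E 3 S}"
    proof
      fix S assume "S \<in> ?m ` ?P"
      then obtain i j k where "S = {i, j, k}" "i \<in> {1..N}" "j \<in> nb i" "k \<in> nb j - {i}" by force
      then show "S \<in> {S. cluster N E 3 S}"
        using cluster3I[of i j k] by (auto simp: nb_def adj_def)
    qed
  qed (auto simp: finite_clusters)
  also have "\<dots> \<le> (\<Sum>S\<in>{S. cluster N E 3 S}. 27 * p ^ card (R E S))"
  proof (intro sum_mono)
    fix S assume S: "S \<in> {S. cluster N E 3 S}"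
    then have card: "card S = 3" "finite S"
      by (auto simp: cluster_def intro: card_ge_0_finite)
    have "{z \<in> ?P. ?m z = S} \<subseteq> S \<times> S \<times> S" by auto
    then have "card {z \<in> ?P. ?m z = S} \<le> card (S \<times> S \<times> S)"
      using card by (intro card_mono) auto
    also have "\<dots> = 27" using card by (simp add: card_cartesian_product)
    finally have "real (card {z \<in> ?P. ?m z = S}) \<le> 27" by simp
    moreover have "(\<Sum>z\<in>{z \<in> ?P. ?m z = S}. p ^ card (R E (?m z))) =
        real (card {z \<in> ?P. ?m z = S}) * p ^ card (R E S)"
      by simp
    ultimately show "(\<Sum>z\<in>{z \<in> ?P. ?m z = S}. p ^ card (R E (?m z))) \<le> 27 * p ^ card (R E S)"
      by (simp add: mult_right_mono)
  qed
  finally show ?thesis by (simp add: \<Delta>_eq sum_distrib_left)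
qed

lemma \<Delta>2_0_eq: "2 * \<Delta>2_0 X N E p = (\<Sum>i\<in>{1..N}. real (card (nb i)) * (p ^ s)\<^sup>2)"
proof -
  have "{(i, j). i \<in> {1..N} \<and> j \<in> {1..N} \<and> adj E i j} = Sigma {1..N} nb"
    by (auto simp: nb_def)
  moreover have "\<P>(W in binomial_subset X p. E i \<subseteq> W) = p ^ s" if "i \<in> {1..N}" for i
    using pr_superset_only[OF edge_subset[OF that]] card_edge[OF that] by simp
  moreover have "j \<in> {1..N}" if "j \<in> nb i" for i j using that nb_subset by blast
  ultimately show ?thesis
    unfolding \<Delta>2_0_def by (simp add: power2_eq_square flip: sum.Sigma)
qed

text \<open>Since the edges are enumerated injectively, an automorphism of the vertices induces a
  permutation of the indices. Invariance of \<open>w3\<close> covers \<open>w2\<close> too, by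
  repeating an index.\<close>

lemma symmetric_permutation:
  assumes "symmetric_hypergraph X N E" "i \<in> {1..N}" "j \<in> {1..N}"
  obtains \<tau> where "bij_betw \<tau> {1..N} {1..N}" "\<tau> i = j"
    "\<And>k l. k \<in> {1..N} \<Longrightarrow> l \<in> {1..N} \<Longrightarrow> adj E (\<tau> k) (\<tau> l) \<longleftrightarrow> adj E k l"
    "\<And>k l m. k \<in> {1..N} \<Longrightarrow> l \<in> {1..N} \<Longrightarrow> m \<in> {1..N} \<Longrightarrow> w3 (\<tau> k) (\<tau> l) (\<tau> m) = w3 k l m"
proof -
  let ?V = "{1..N}"
  obtain \<sigma> where \<sigma>: "hypergraph_automorphism X N E \<sigma>" "\<sigma> ` E i = E j"
    using assms unfolding symmetric_hypergraph_def by blast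
  have inj: "inj_on \<sigma> X" using \<sigma>(1) by (auto simp: hypergraph_automorphism_def bij_betw_def)
  define \<tau> where "\<tau> k = inv_into ?V E (\<sigma> ` E k)" for k
  have im: "\<sigma> ` E k \<in> E ` ?V" if "k \<in> ?V" for k
    using \<sigma>(1) that unfolding hypergraph_automorphism_def by blast
  have E\<tau>: "E (\<tau> k) = \<sigma> ` E k" if "k \<in> ?V" for k
    unfolding \<tau>_def by (rule f_inv_into_f[OF im[OF that]])
  have \<tau>V: "\<tau> k \<in> ?V" if "k \<in> ?V" for k
    unfolding \<tau>_def by (rule inv_into_into[OF im[OF that]])
  have inj\<tau>: "inj_on \<tau> ?V"
  proof (rule inj_onI)
    fix k l assume kl: "k \<in> ?V" "l \<in> ?V" "\<tau> k = \<tau> l"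
    then have "\<sigma> ` E k = \<sigma> ` E l" using E\<tau> by metis
    then have "E k = E l"
      using inj_on_image_eq_iff[OF inj edge_subset edge_subset, OF kl(1,2)] by blast
    then show "k = l" using inj_edge kl by (auto dest: inj_onD)
  qed
  have "bij_betw \<tau> ?V ?V"
    unfolding bij_betw_def using inj\<tau> \<tau>V endo_inj_surj[of ?V \<tau>] by blast
  moreover have "\<tau> i = j"
    unfolding \<tau>_def \<sigma>(2) using inj_edge assms(3) by (rule inv_into_f_f)
  moreover have "adj E (\<tau> k) (\<tau> l) \<longleftrightarrow> adj E k l" if kl: "k \<in> ?V" "l \<in> ?V" for k l
  proof -
    have "\<tau> k = \<tau> l \<longleftrightarrow> k = l" using inj\<tau> kl by (auto dest: inj_onD)
    moreover have "\<sigma> ` E k \<inter> \<sigma> ` E l = \<sigma> ` (E k \<inter> E l)"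
      using inj_on_image_Int[OF inj edge_subset edge_subset, OF kl] by simp
    ultimately show ?thesis by (simp add: adj_def E\<tau>[OF kl(1)] E\<tau>[OF kl(2)])
  qed
  moreover have "w3 (\<tau> k) (\<tau> l) (\<tau> m) = w3 k l m"
    if klm: "k \<in> ?V" "l \<in> ?V" "m \<in> ?V" for k l m
  proof -
    have "E k \<union> E l \<union> E m \<subseteq> X" using edge_subset klm by simp
    then have "card (\<sigma> ` (E k \<union> E l \<union> E m)) = card (E k \<union> E l \<union> E m)"
      using inj inj_on_subset card_image by metis
    then show ?thesis by (simp only: E\<tau>[OF klm(1)] E\<tau>[OF klm(2)] E\<tau>[OF klm(3)] image_Un)
  qed
  ultimately show thesis by (rule that)
qed

lemma degrees_const:
  assumes "symmetric_hypergraph X N E" "i \<in> {1..N}" "j \<in> {1..N}"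
  shows "card (nb i) = card (nb j)" "adeg i = adeg j" "bdeg i = bdeg j"
proof -
  let ?V = "{1..N}"
  obtain \<tau> where \<tau>: "bij_betw \<tau> ?V ?V" "\<tau> i = j"
    and adj: "\<And>k l. k \<in> ?V \<Longrightarrow> l \<in> ?V \<Longrightarrow> adj E (\<tau> k) (\<tau> l) \<longleftrightarrow> adj E k l"
    and w: "\<And>k l m. k \<in> ?V \<Longrightarrow> l \<in> ?V \<Longrightarrow> m \<in> ?V \<Longrightarrow> w3 (\<tau> k) (\<tau> l) (\<tau> m) = w3 k l m"
    using symmetric_permutation[OF assms] by metis
  have inj: "inj_on \<tau> ?V" and im: "\<tau> ` ?V = ?V" using \<tau>(1) by (auto simp: bij_betw_def)
  have nb: "nb (\<tau> k) = \<tau> ` nb k" if k: "k \<in> ?V" for k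
  proof -
    have "nb (\<tau> k) = {l \<in> \<tau> ` ?V. adj E (\<tau> k) l}" by (simp only: nb_def im)
    also have "\<dots> = \<tau> ` {l \<in> ?V. adj E (\<tau> k) (\<tau> l)}" by auto
    also have "{l \<in> ?V. adj E (\<tau> k) (\<tau> l)} = nb k" using adj[OF k] by (auto simp: nb_def)
    finally show ?thesis .
  qed
  have inj_nb: "inj_on \<tau> (nb k)" for k using inj nb_subset inj_on_subset by blast
  show "card (nb i) = card (nb j)"
    using nb[OF assms(2)] card_image[OF inj_nb[of i]] by (simp add: \<tau>(2))
  have "adeg (\<tau> i) = (\<Sum>k\<in>nb i. w2 (\<tau> i) (\<tau> k))"
    unfolding adeg_def nb[OF assms(2)] by (rule sum.reindex_cong[OF inj_nb]) auto
  also have "\<dots> = adeg i"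
    unfolding adeg_def using w[of i _ i] assms(2) nb_subset[of i]
    by (intro sum.cong refl) (simp add: Un_ac subset_iff)
  finally show "adeg i = adeg j" by (simp add: \<tau>(2))
  have "bdeg (\<tau> i) = (\<Sum>k\<in>nb i. \<Sum>l\<in>nb (\<tau> k) - {\<tau> i}. w3 (\<tau> i) (\<tau> k) l)"
    unfolding bdeg_def nb[OF assms(2)] by (rule sum.reindex_cong[OF inj_nb]) auto
  also have "\<dots> = bdeg i"
    unfolding bdeg_def
  proof (rule sum.cong[OF refl])
    fix k assume "k \<in> nb i"
    then have k: "k \<in> ?V" using nb_subset by blast
    have "nb (\<tau> k) - {\<tau> i} = \<tau> ` (nb k - {i})"
      using inj_on_image_set_diff[OF inj, of "nb k" "{i}"] nb[OF k] nb_subset[of k] assms(2) by auto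
    moreover have "inj_on \<tau> (nb k - {i})" using inj_nb[of k] by (rule inj_on_subset) auto
    ultimately have "(\<Sum>l\<in>nb (\<tau> k) - {\<tau> i}. w3 (\<tau> i) (\<tau> k) l) = (\<Sum>l\<in>nb k - {i}. w3 (\<tau> i) (\<tau> k) (\<tau> l))"
      by (simp add: sum.reindex)
    also have "\<dots> = (\<Sum>l\<in>nb k - {i}. w3 i k l)"
      using nb_subset[of k] by (intro sum.cong refl w assms(2) k) blast
    finally show "(\<Sum>l\<in>nb (\<tau> k) - {\<tau> i}. w3 (\<tau> i) (\<tau> k) l) = (\<Sum>l\<in>nb k - {i}. w3 i k l)" .
  qed
  finally show "bdeg i = bdeg j" by (simp add: \<tau>(2))
qed

end

section \<open>The logarithm of the conditional avoidance probability\<close>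

context conditioned_model
begin

lemma prob_contained_eq_Z: "prob_contained_eq X N E p Y = p ^ card (R E Y) * Z G ({1..N} - Y)"
proof -
  have "contained_edges N E W = Y \<longleftrightarrow> R E Y \<subseteq> W \<and> (\<forall>j\<in>{1..N} - Y. \<not> E j \<subseteq> W)" for W
    using Y_subset unfolding contained_edges_def R_def by blast
  moreover have "R E Y \<subseteq> X" using Y_subset edge_subset unfolding R_def by blast
  moreover have "E j \<subseteq> R E Y \<union> W \<longleftrightarrow> G j \<subseteq> W" for j W by (auto simp: G_def)
  ultimately show ?thesis
    using pr_superset[of "R E Y" "\<lambda>W. \<forall>j\<in>{1..N} - Y. \<not> E j \<subseteq> W"]
    by (simp add: prob_contained_eq_def avoid_def)
qed

lemma p_pow_R: "p ^ card (R E Y) = pi_s ^ card Y * p powi (- t E s Y)"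
proof -
  have "p powi (- t E s Y) = p powi (int (card (R E Y)) - int (s * card Y))"
    by (simp add: t_def)
  also have "\<dots> = p ^ card (R E Y) / p ^ (s * card Y)"
    using p_pos by (subst power_int_diff) (simp_all only: power_int_of_nat, simp)
  finally show ?thesis using p_pos by (simp add: power_mult)
qed

lemma Z_G_pos: "Z G ({1..N} - Y) > 0"
  using not_covered by (intro Z_pos) (auto simp: G_def)

definition err :: real where
  "err = B\<^sub>N + f * A\<^sub>N + f * (2 * Q2 E Y) + Q3 X N E p Y + Q4 X N E p Y
     + pi_s\<^sup>2 * real N + complex_sum N E p Y"

text \<open>Up to errors, the isolated indices contribute half the full pair sum. By
  \<open>first_order\<close> the simple ones contribute 2|Y|/mu times the same quantity with the
  opposite sign, whence the coefficient. The constant takes the larger of the coefficients in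
  \<open>up\<close> and \<open>low\<close> term by term; 3 L is half of the 4 L + 2 L in
  \<open>pairs_bounds\<close>.\<close>

lemma ln_Z_G_bound:
  defines "l \<equiv> ln (1 - pi_s)"
  shows "\<bar>ln (Z G ({1..N} - Y)) - real (N - card Y) * l
      + (2 * real (card Y) / (pi_s * real N) - 1) * ((A\<^sub>N - D\<^sub>N) / 2)\<bar>
    \<le> (2 * (4 + 2 / c) + 3 * L + 2 + 2 / c + L / c' + 1 / c') * err"
proof -
  let ?Z = "Z G ({1..N} - Y)" and ?C = "complex_sum N E p Y" and ?P0 = "pairs J0 J0"
  let ?n0 = "real (card J0)" and ?n1 = "real (card J1)" and ?n2 = "real (card JC)"
  define PN where "PN = pi_s\<^sup>2 * real N"
  define M where "M = 4 + 2 / c"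
  define V where "V = real (card Y) * (A\<^sub>N - D\<^sub>N) / (pi_s * real N)"
  define rest where "rest = V - ((\<Sum>j\<in>J1. q j) - ?n1 * pi_s)"
  have rest: "0 \<le> rest" "rest \<le> Q3s + f * (2 * Q2 E Y)"
    using first_order by (auto simp: rest_def V_def)
  have M: "M \<ge> 0" using c_pos by (simp add: M_def)
  have ZJ0: "Z G J0 = Z E J0" using G_simps(1) by (intro avoid_cong) auto
  have ZJ0_pos: "Z E J0 > 0" using edge_nonempty J0_mem by (intro Z_pos) blast
  have nonneg: "B\<^sub>N \<ge> 0" "f * A\<^sub>N \<ge> 0" "f * (2 * Q2 E Y) \<ge> 0" "Q3 X N E p Y \<ge> 0" "Q4 X N E p Y \<ge> 0"
    "PN \<ge> 0" "?C \<ge> 0"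
    using A\<^sub>N_nonneg B\<^sub>N_nonneg f_nonneg Q2_eq
    by (auto simp: Q3_def Q4_def complex_sum_def cond_prob_def Q2_def PN_def intro!: sum_nonneg)
  have part_card: "N - card Y = card J0 + (card J1 + card JC)"
  proof -
    have "N - card Y = card ({1..N} - Y)" using Y_subset by (simp add: card_Diff_subset)
    also have "\<dots> = card J0 + (card J1 + card JC)"
      unfolding partition(1) using partition(2,3) by (simp add: card_Un_disjoint)
    finally show ?thesis .
  qed
  have isolated: "\<bar>ln (Z E J0) - ?n0 * l - 1 / 2 * ?P0\<bar> \<le> M * (2 * B\<^sub>N + f * A\<^sub>N + PN)"
  proof -
    have "(\<Sum>j\<in>J0. bdeg j + cdeg j + f * adeg j + pi_s\<^sup>2) \<le>
        (\<Sum>j\<in>{1..N}. bdeg j + cdeg j + f * adeg j + pi_s\<^sup>2)"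
      using J_subset(1) adeg_nonneg bdeg_nonneg cdeg_nonneg f_nonneg
      by (intro sum_mono2) (auto intro!: add_nonneg_nonneg)
    also have "\<dots> = 2 * B\<^sub>N + f * A\<^sub>N + PN"
      using sum_cdeg by (simp add: sum.distrib A\<^sub>N_def B\<^sub>N_def PN_def sum_distrib_left)
    finally show ?thesis
      using ln_Z_bound[OF J_subset(1)] M mult_left_mono unfolding M_def l_def by (meson order_trans)
  qed
  have upper: "ln ?Z \<le> ln (Z E J0) + (\<Sum>j\<in>J1. v j) - (\<Sum>j\<in>J1. q j)"
  proof -
    have "?Z \<le> Z G (J0 \<union> J1)" unfolding partition(1) by (rule avoid_antimono) blast
    also have "\<dots> \<le> Z G J0 * exp (\<Sum>j\<in>J1. v j - q j)"
    proof (rule Z_Un_le)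
      show "G j \<subseteq> X" if "j \<in> J0 \<union> J1" for j using that G_subset J_subset by blast
      show "J1 \<inter> J0 = {}" using partition(4) by blast
    qed (simp_all only: finite_J v_ge)
    finally have "ln ?Z \<le> ln (Z E J0 * exp (\<Sum>j\<in>J1. v j - q j))"
      using Z_G_pos ZJ0 by simp
    also have "\<dots> = ln (Z E J0) + (\<Sum>j\<in>J1. v j - q j)"
      using ZJ0_pos by (simp add: ln_mult)
    finally show ?thesis by (simp add: sum_subtractf)
  qed
  \<comment> \<open>The quadratic terms of simple indices are summed by \<open>sum_q2_le\<close>;
    for complex indices bounding the square by q j itself suffices, as C(Y) is an admissible
    error.\<close>
  have lower: "ln ?Z \<ge> ln (Z E J0) - (\<Sum>j\<in>J1. q j) - L / c' * (f * A\<^sub>N) - (1 + 1 / c') * ?C"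
  proof -
    have q1: "0 < 1 - q j" if "j \<in> J1 \<union> JC" for j
      using that q_le[of j] c'_pos J1_mem JC_mem by fastforce
    have "Z G J0 * (\<Prod>j\<in>J1 \<union> JC. 1 - q j) \<le> ?Z"
      unfolding partition(1)
    proof (rule Z_Un_ge)
      show "G j \<subseteq> X" if "j \<in> J1 \<union> JC" for j using that G_subset J_subset by blast
      show "(J1 \<union> JC) \<inter> J0 = {}" using partition(2) by blast
    qed simp
    then have "ln (Z E J0 * (\<Prod>j\<in>J1 \<union> JC. 1 - q j)) \<le> ln ?Z"
      unfolding ZJ0 using ZJ0_pos q1 by (intro ln_mono mult_pos_pos prod_pos)
    moreover have "ln (Z E J0 * (\<Prod>j\<in>J1 \<union> JC. 1 - q j)) =
        ln (Z E J0) + (\<Sum>j\<in>J1 \<union> JC. ln (1 - q j))"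
    proof -
      have "(\<Prod>j\<in>J1 \<union> JC. 1 - q j) > 0" by (intro prod_pos q1)
      then have "ln (Z E J0 * (\<Prod>j\<in>J1 \<union> JC. 1 - q j)) = ln (Z E J0) + ln (\<Prod>j\<in>J1 \<union> JC. 1 - q j)"
        using ZJ0_pos by (intro ln_mult_pos)
      also have "ln (\<Prod>j\<in>J1 \<union> JC. 1 - q j) = (\<Sum>j\<in>J1 \<union> JC. ln (1 - q j))"
        using q1 by (intro ln_prod) fastforce+
      finally show ?thesis .
    qed
    moreover have "(\<Sum>j\<in>J1 \<union> JC. ln (1 - q j)) = (\<Sum>j\<in>J1. ln (1 - q j)) + (\<Sum>j\<in>JC. ln (1 - q j))"
      using partition(3) by (intro sum.union_disjoint) auto
    moreover have "(\<Sum>j\<in>J1. ln (1 - q j)) \<ge> (\<Sum>j\<in>J1. - q j - (q j)\<^sup>2 / c')"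
      using q_le J1_mem c'_pos by (intro sum_mono ln_one_minus_ge) auto
    moreover have "(\<Sum>j\<in>J1. - q j - (q j)\<^sup>2 / c') = - (\<Sum>j\<in>J1. q j) - (\<Sum>j\<in>J1. (q j)\<^sup>2) / c'"
      by (simp add: sum_subtractf sum_negf sum_divide_distrib)
    moreover have "(\<Sum>j\<in>J1. (q j)\<^sup>2) / c' \<le> L / c' * (f * A\<^sub>N)"
      using divide_right_mono[OF sum_q2_le, of c'] c'_pos by simp
    moreover have "(\<Sum>j\<in>JC. ln (1 - q j)) \<ge> (\<Sum>j\<in>JC. - ((1 + 1 / c') * q j))"
    proof (intro sum_mono)
      fix j assume j: "j \<in> JC"
      have "q j \<le> 1" using p_pos p_less_1 by (intro power_le_one) auto
      then have "(q j)\<^sup>2 / c' \<le> q j / c'"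
        using c'_pos by (intro divide_right_mono) (auto simp: power2_eq_square mult_left_le)
      moreover have "ln (1 - q j) \<ge> - q j - (q j)\<^sup>2 / c'"
        using q_le[OF JC_mem[OF j]] c'_pos by (intro ln_one_minus_ge) auto
      ultimately show "- ((1 + 1 / c') * q j) \<le> ln (1 - q j)" by (simp add: algebra_simps)
    qed
    moreover have "(\<Sum>j\<in>JC. - ((1 + 1 / c') * q j)) = - ((1 + 1 / c') * ?C)"
      by (simp add: complex_sum_eq sum_distrib_left sum_negf)
    ultimately show ?thesis by linarith
  qed
  have l: "l \<le> - pi_s" "l \<ge> - pi_s - pi_s\<^sup>2 / c"
    using ln_add_one_self_le_self2[of "- pi_s"] ln_one_minus_ge[of pi_s c] c_pos c_le p_pos
    by (auto simp: l_def)
  \<comment> \<open>The factor (1 - pi)^(N - |Y|) also counts simple and complex indices, so their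
    copies of \<open>l\<close> must be compensated. For simple ones they cancel the pi in
    \<open>first_order\<close> up to pi^2/c; for complex ones (\<open>n2\<close>) they are charged
    to C(Y) through pi <= q j.\<close>
  have n1: "?n1 * l \<le> - (?n1 * pi_s)" "?n1 * l \<ge> - (?n1 * pi_s) - (PN) / c"
  proof -
    show "?n1 * l \<le> - (?n1 * pi_s)" using mult_left_mono[OF l(1), of ?n1] by simp
    have "?n1 \<le> real N" using card_mono[OF _ J_subset(2)] by simp
    then have "?n1 * (pi_s\<^sup>2 / c) \<le> real N * (pi_s\<^sup>2 / c)"
      using c_pos by (intro mult_right_mono) auto
    moreover have "?n1 * l \<ge> ?n1 * (- pi_s - pi_s\<^sup>2 / c)" using l(2) by (rule mult_left_mono) simp
    ultimately show "?n1 * l \<ge> - (?n1 * pi_s) - (PN) / c" by (simp add: PN_def algebra_simps)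
  qed
  have n2: "?n2 * l \<le> 0" "?n2 * l \<ge> - ((1 + 1 / c) * ?C)"
  proof -
    have "?n2 * pi_s = (\<Sum>j\<in>JC. pi_s)" by simp
    also have "\<dots> \<le> ?C"
      unfolding complex_sum_eq using J_subset(3) by (intro sum_mono pi_le_q) blast
    finally have C: "?n2 * pi_s \<le> ?C" .
    have "pi_s\<^sup>2 / c \<le> pi_s / c"
      using c_pos p_pos p_less_1
      by (intro divide_right_mono) (auto simp: power2_eq_square mult_left_le power_le_one)
    then have "- ((1 + 1 / c) * pi_s) \<le> l" using l(2) by (simp add: algebra_simps)
    then have "?n2 * (- ((1 + 1 / c) * pi_s)) \<le> ?n2 * l" by (rule mult_left_mono) simp
    moreover have "(1 + 1 / c) * (?n2 * pi_s) \<le> (1 + 1 / c) * ?C"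
      using C c_pos by (intro mult_left_mono) auto
    ultimately show "?n2 * l \<ge> - ((1 + 1 / c) * ?C)" by (simp add: mult_ac)
    show "?n2 * l \<le> 0" using l(1) pi_pos by (intro mult_nonneg_nonpos) auto
  qed
  let ?\<eta> = "ln ?Z - real (N - card Y) * l + (2 * real (card Y) / (pi_s * real N) - 1) * ((A\<^sub>N - D\<^sub>N) / 2)"
  have \<eta>: "?\<eta> = ln ?Z - (?n0 * l + (?n1 * l + ?n2 * l)) + V - (A\<^sub>N - D\<^sub>N) / 2"
    unfolding part_card V_def by (simp add: algebra_simps add_divide_distrib diff_divide_distrib)
  have le: "B\<^sub>N \<le> err" "f * A\<^sub>N \<le> err" "2 * B\<^sub>N + f * A\<^sub>N + PN \<le> 2 * err"
      "Q3 X N E p Y + Q4 X N E p Y + f * (2 * Q2 E Y) \<le> err" "PN \<le> err" "?C \<le> err"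
  proof -
    have "b \<le> e" "a \<le> e" "2 * b + a + z \<le> 2 * e" "x + y + q \<le> e" "z \<le> e" "w \<le> e"
      if "b \<ge> 0" "a \<ge> 0" "q \<ge> 0" "x \<ge> 0" "y \<ge> 0" "z \<ge> 0" "w \<ge> 0" "e = b + a + q + x + y + z + w"
      for a b e q x y z w :: real
      using that by linarith+
    from this[OF nonneg err_def[folded PN_def]]
    show "B\<^sub>N \<le> err" "f * A\<^sub>N \<le> err" "2 * B\<^sub>N + f * A\<^sub>N + PN \<le> 2 * err"
      "Q3 X N E p Y + Q4 X N E p Y + f * (2 * Q2 E Y) \<le> err" "PN \<le> err" "?C \<le> err" .
  qed
  have bounds: "M * (2 * B\<^sub>N + f * A\<^sub>N + PN) \<le> M * (2 * err)"
    "L * B\<^sub>N \<le> L * err" "L * (f * A\<^sub>N) \<le> L * err" "(PN) / c \<le> err / c"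
    "(1 + 1 / c) * ?C \<le> (1 + 1 / c) * err"
    "L / c' * (f * A\<^sub>N) \<le> L / c' * err" "(1 + 1 / c') * ?C \<le> (1 + 1 / c') * err"
    using le M L_pos c_pos c'_pos
    by (intro mult_left_mono divide_right_mono; simp)+
  have err0: "0 \<le> err" "0 \<le> L * err" "0 \<le> err / c" "0 \<le> L / c' * err" "0 \<le> err / c'"
    using le nonneg L_pos c_pos c'_pos by auto
  have pb: "?P0 \<le> A\<^sub>N - D\<^sub>N" "A\<^sub>N - D\<^sub>N - ?P0 \<le> 4 * (L * (f * A\<^sub>N)) + 2 * (L * B\<^sub>N)"
    using pairs_bounds by (simp_all add: mult.assoc)
  have expand: "(2 * (4 + 2 / c) + 3 * L + 2 + 2 / c + L / c' + 1 / c') * err =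
      M * (2 * err) + 3 * (L * err) + 2 * err + 2 * (err / c) + L / c' * err + err / c'"
    by (simp add: M_def algebra_simps)
  have e1: "(1 + 1 / c) * err = err + err / c" "(1 + 1 / c') * err = err + err / c'"
    by (simp_all add: algebra_simps)
  let ?Q = "\<Sum>j\<in>J1. q j"
  have V: "V = rest + ?Q - ?n1 * pi_s" by (simp add: rest_def)
  have up: "?\<eta> \<le> M * (2 * err) + L * err + 2 * err + 2 * (err / c)"
  proof -
    have "z - (k0 + (k1 + k2)) + vv - d / 2 \<le> m' + b' + 2 * e + 2 * ec"
      if "vv = r + sq - n1" "z0 - k0 - 1 / 2 * p0 \<le> m" "z \<le> z0 + sv - sq" "sv \<le> b + x4" "r \<le> x3 + y2"
        "x3 \<le> y3" "x4 \<le> y4" "- n1 - pc \<le> k1" "- cc \<le> k2" "m \<le> m'" "b \<le> b'" "pc \<le> ec"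
        "cc \<le> e + ec" "y3 + y4 + y2 \<le> e" "p0 \<le> d"
      for z z0 k0 k1 k2 vv d m m' b b' e ec r sq n1 p0 sv x3 x4 y2 y3 y4 pc cc :: real
      using that by linarith
    from this[OF V isolated[THEN abs_le_D1] upper sum_v_le rest(2) Q3s_le Q4s_le n1(2) n2(2)
      bounds(1,2,4,5)[unfolded e1] le(4) pb(1)]
    show ?thesis unfolding \<eta> .
  qed
  have low: "- ?\<eta> \<le> M * (2 * err) + 3 * (L * err) + L / c' * err + err + err / c'"
  proof -
    have "- (z - (k0 + (k1 + k2)) + vv - d / 2) \<le> m' + 3 * b' + a' + e + ec"
      if "vv = r + sq - n1" "- (z0 - k0 - 1 / 2 * p0) \<le> m" "z0 - sq - a - cc \<le> z" "0 \<le> r"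
        "k1 \<le> - n1" "k2 \<le> 0" "m \<le> m'" "b \<le> b'" "fa \<le> b'" "a \<le> a'" "cc \<le> e + ec"
        "d - p0 \<le> 4 * fa + 2 * b"
      for z z0 k0 k1 k2 vv d m m' a a' b b' fa e ec r sq n1 p0 cc :: real
      using that by linarith
    from this[OF V isolated[THEN abs_le_D2] lower rest(1) n1(1) n2(1) bounds(1,2,3,6,7)[unfolded e1] pb(2)]
    show ?thesis unfolding \<eta> .
  qed
  show ?thesis
    using up low err0 unfolding expand abs_le_iff by linarith
qed

end

section \<open>Deriving the assumptions of the conditioned model\<close>

context hypergraph_model
begin

lemma possible_not_covered:
  assumes "possible X N E p Y" "j \<in> {1..N} - Y"
  shows "\<not> E j \<subseteq> R E Y"
proof
  assume sub: "E j \<subseteq> R E Y"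
  have "prob_contained_eq X N E p Y \<noteq> 0" using assms(1) by (simp add: possible_def)
  then obtain W where "contained_edges N E W = Y"
    unfolding prob_contained_eq_def measure_pmf_zero_iff by blast
  then have "j \<in> Y" using sub assms(2) unfolding contained_edges_def R_def by blast
  then show False using assms(2) by blast
qed

lemma \<phi>_ge:
  assumes "i \<in> {1..N}" "j \<in> {1..N}" "i \<noteq> j"
  shows "p ^ card (E i - E j) \<le> \<phi> X N E p"
proof -
  let ?P = "\<lambda>i j. \<P>(W in binomial_subset X p. E i \<subseteq> W \<bar> E j \<subseteq> W)"
  have "{?P i j | i j. i \<in> {1..N} \<and> j \<in> {1..N} \<and> i \<noteq> j} \<subseteq> (\<lambda>(i, j). ?P i j) ` ({1..N} \<times> {1..N})"
    by auto
  then have "finite {?P i j | i j. i \<in> {1..N} \<and> j \<in> {1..N} \<and> i \<noteq> j}"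
    by (rule finite_subset) simp
  then have "?P i j \<le> \<phi> X N E p"
    unfolding \<phi>_def using assms by (intro Max_ge) auto
  then show ?thesis
    using cond_prob_superset[OF edge_subset edge_subset, OF assms(1,2)] by simp
qed

text \<open>By symmetry all degrees equal some d, so 2 Delta_2^0 = N d pi^2, and comparison with
  mu/2 = N pi/2 gives d pi <= 1/2.\<close>

lemma degree_le:
  assumes "symmetric_hypergraph X N E" "\<Delta>2_0 X N E p \<le> \<mu> N s p / 4" "i \<in> {1..N}"
  shows "real (card (nb i)) * p ^ s \<le> 1 / 2"
proof -
  have "(\<Sum>j\<in>{1..N}. real (card (nb j)) * (p ^ s)\<^sup>2) = (\<Sum>j\<in>{1..N}. real (card (nb i)) * (p ^ s)\<^sup>2)"
    using degrees_const(1)[OF assms(1) _ assms(3)] by (intro sum.cong) auto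
  then have "2 * \<Delta>2_0 X N E p = real N * (real (card (nb i)) * (p ^ s)\<^sup>2)"
    by (simp add: \<Delta>2_0_eq)
  then have "(real N * p ^ s) * (real (card (nb i)) * p ^ s) \<le> (real N * p ^ s) * (1 / 2)"
    using assms(2) by (simp add: \<mu>_def power2_eq_square mult_ac)
  moreover have "real N * p ^ s > 0" using assms(3) p_pos by simp
  ultimately show ?thesis by (rule mult_left_le_imp_le)
qed

end

theorem theorem5p1:
  fixes c\<^sub>\<pi> c\<^sub>p K L :: real
  assumes "c\<^sub>\<pi> > 0" and "c\<^sub>p > 0" and "K > 0" and "L > 0"
  shows "\<exists>B>0. \<forall>(X :: 'a set) (N :: nat) (E :: nat \<Rightarrow> 'a set) (s :: nat) (p :: real).
    uniform_hypergraph X N E s \<and> symmetric_hypergraph X N E \<and>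
    0 < p \<and> p < 1 \<and>
    1 - p ^ s \<ge> c\<^sub>\<pi> \<and>
    1 - p \<ge> c\<^sub>p \<and>
    \<Delta>2_0 X N E p \<le> \<mu> N s p / 4 \<and>
    \<phi> X N E p * \<Delta> X N E p 2 \<le> K * \<Delta> X N E p 3 \<longrightarrow>
    (\<forall>Y. possible X N E p Y \<and> real (card Y) \<le> L * \<mu> N s p \<longrightarrow>
      (\<exists>\<eta> :: real.
        \<bar>\<eta>\<bar> \<le> B * (\<Delta> X N E p 3 + \<phi> X N E p * Q2 E Y + Q3 X N E p Y + Q4 X N E p Y
                     + (p ^ s)\<^sup>2 * real N + complex_sum N E p Y) \<and>
        prob_contained_eq X N E p Y =
          (p ^ s) ^ card Y * (1 - p ^ s) ^ (N - card Y) * p powi (- t E s Y) *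
          exp (- (2 * real (card Y) / \<mu> N s p - 1) * (\<Delta> X N E p 2 - \<Delta>2_0 X N E p) + \<eta>)))"
proof -
  define B where "B = (2 * (4 + 2 / c\<^sub>\<pi>) + 3 * L + 2 + 2 / c\<^sub>\<pi> + L / c\<^sub>p + 1 / c\<^sub>p)"
  have B: "B > 0" using assms by (simp add: B_def add_pos_pos)
  have goal: "\<exists>\<eta> :: real.
        \<bar>\<eta>\<bar> \<le> B * (27 + 2 * K) * (\<Delta> X N E p 3 + \<phi> X N E p * Q2 E Y + Q3 X N E p Y + Q4 X N E p Y
                     + (p ^ s)\<^sup>2 * real N + complex_sum N E p Y) \<and>
        prob_contained_eq X N E p Y =
          (p ^ s) ^ card Y * (1 - p ^ s) ^ (N - card Y) * p powi (- t E s Y) *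
          exp (- (2 * real (card Y) / \<mu> N s p - 1) * (\<Delta> X N E p 2 - \<Delta>2_0 X N E p) + \<eta>)"
    if hyp: "uniform_hypergraph X N E s" "symmetric_hypergraph X N E" "0 < p" "p < 1"
      "1 - p ^ s \<ge> c\<^sub>\<pi>" "1 - p \<ge> c\<^sub>p" "\<Delta>2_0 X N E p \<le> \<mu> N s p / 4"
      "\<phi> X N E p * \<Delta> X N E p 2 \<le> K * \<Delta> X N E p 3"
      "possible X N E p Y" "real (card Y) \<le> L * \<mu> N s p"
    for X :: "'a set" and N E s p Y
  proof -
    \<comment> \<open>For s = 0 the probability pi would be 1, against the lower bound on 1 -
      pi.\<close>
    have "s > 0" using hyp(5) assms(1) by (cases s) auto
    then interpret hypergraph_model X p N E s
      using hyp by unfold_locales (auto simp: uniform_hypergraph_def)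
    \<comment> \<open>\<open>\<phi>\<close> is a maximum over the empty set if \<open>N < 2\<close>.\<close>
    define f where "f = (if N \<ge> 2 then \<phi> X N E p else 0)"
    have small: "nb i = {}" if "i \<in> {1..N}" "\<not> N \<ge> 2" for i
      using that by (auto simp: nb_def adj_def)
    interpret conditioned_model X p N E s c\<^sub>\<pi> f Y L c\<^sub>p
    proof unfold_locales
      have "0 \<le> \<phi> X N E p" if "N \<ge> 2"
      proof -
        have "p ^ card (E 1 - E 2) \<le> \<phi> X N E p" using that by (intro \<phi>_ge) auto
        then show ?thesis using pow_p_nonneg[of "card (E 1 - E 2)"] by linarith
      qed
      then show "0 \<le> f" by (simp add: f_def)
      show "p ^ card (E j - E i) \<le> f" if "i \<in> {1..N}" "j \<in> {1..N}" "adj E i j" for i j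
      proof -
        have ne: "i \<noteq> j" using that(3) by (simp add: adj_def)
        then have "N \<ge> 2" using that(1,2) by auto
        then show ?thesis using \<phi>_ge[of j i] that ne by (simp add: f_def)
      qed
      show "real (card (nb i)) * p ^ s \<le> 1 / 2" if "i \<in> {1..N}" for i
        using degree_le[OF hyp(2,7) that] .
      show "Y \<subseteq> {1..N}" using hyp(9) by (simp add: possible_def)
      show "real (card Y) \<le> L * (p ^ s * real N)" using hyp(10) by (simp add: \<mu>_def)
      show "\<not> E j \<subseteq> R E Y" if "j \<in> {1..N} - Y" for j
        using possible_not_covered[OF hyp(9) that] .
    qed (fact assms hyp degrees_const[OF hyp(2)])+
    define S where "S = \<Delta> X N E p 3 + \<phi> X N E p * Q2 E Y + Q3 X N E p Y + Q4 X N E p Y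
                     + (p ^ s)\<^sup>2 * real N + complex_sum N E p Y"
    have A: "A\<^sub>N = 2 * \<Delta> X N E p 2" and D: "D\<^sub>N = 2 * \<Delta>2_0 X N E p" and Bn: "B\<^sub>N \<le> 27 * \<Delta> X N E p 3"
      using adeg_sum_eq \<Delta>2_0_eq bdeg_sum_le by (simp_all add: A\<^sub>N_def B\<^sub>N_def D\<^sub>N_def)
    have f\<Delta>: "f * \<Delta> X N E p 2 = \<phi> X N E p * \<Delta> X N E p 2" and fQ: "f * Q2 E Y = \<phi> X N E p * Q2 E Y"
    proof -
      have "\<Delta> X N E p 2 = 0 \<and> Q2 E Y = 0" if "\<not> N \<ge> 2"
      proof
        have "A\<^sub>N = 0" unfolding A\<^sub>N_def adeg_def using small[OF _ that] by simp
        then show "\<Delta> X N E p 2 = 0" using A by simp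
        have "2 * Q2 E Y = 0" unfolding Q2_eq using small[OF _ that] Y_subset by (intro sum.neutral) auto
        then show "Q2 E Y = 0" by simp
      qed
      then show "f * \<Delta> X N E p 2 = \<phi> X N E p * \<Delta> X N E p 2" "f * Q2 E Y = \<phi> X N E p * Q2 E Y"
        by (auto simp: f_def)
    qed
    \<comment> \<open>Taken to be the exact discrepancy, so that the identity holds by construction
      and only its size is at stake.\<close>
    define \<eta> where "\<eta> = ln (Z G ({1..N} - Y)) - real (N - card Y) * ln (1 - p ^ s)
      + (2 * real (card Y) / (p ^ s * real N) - 1) * ((A\<^sub>N - D\<^sub>N) / 2)"
    have nonneg: "0 \<le> \<Delta> X N E p 3" "0 \<le> \<phi> X N E p * Q2 E Y" "0 \<le> Q3 X N E p Y" "0 \<le> Q4 X N E p Y"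
      "0 \<le> (p ^ s)\<^sup>2 * real N" "0 \<le> complex_sum N E p Y"
      using \<Delta>_nonneg f_nonneg fQ[symmetric]
      by (auto simp: Q3_def Q4_def complex_sum_def cond_prob_def Q2_def intro!: sum_nonneg)
    \<comment> \<open>The 27 comes from \<open>bdeg_sum_le\<close> and dominates the factor 2 at phi
      Q_2; the 2 K comes from \<open>f\<close> times 2 Delta_2 and the hypothesis phi Delta_2 <= K
      Delta_3.\<close>
    have "err \<le> (27 + 2 * K) * S"
    proof -
      have "f * A\<^sub>N \<le> 2 * (K * \<Delta> X N E p 3)"       proof -
        have "f * A\<^sub>N = 2 * (f * \<Delta> X N E p 2)" by (simp add: A)
        then show ?thesis using hyp(8) unfolding f\<Delta> by linarith
      qed
      moreover have "f * (2 * Q2 E Y) = 2 * (\<phi> X N E p * Q2 E Y)" unfolding fQ[symmetric] by simp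
      moreover have "e \<le> 27 * S' + 2 * kd"
        if "fa \<le> 2 * kd" "fq = 2 * y" "b \<le> 27 * d" "0 \<le> d" "0 \<le> y" "0 \<le> x3" "0 \<le> x4"
          "0 \<le> z" "0 \<le> w" "e = b + fa + fq + x3 + x4 + z + w" "S' = d + y + x3 + x4 + z + w"
        for e fa fq y b d x3 x4 z w kd S' :: real
        using that by linarith
      ultimately have "err \<le> 27 * S + 2 * (K * \<Delta> X N E p 3)"
        using Bn nonneg err_def S_def by blast
      also have "K * \<Delta> X N E p 3 \<le> K * S"
        using nonneg assms(3) by (intro mult_left_mono) (auto simp: S_def)
      finally have "err \<le> 27 * S + 2 * (K * S)" by simp
      then show ?thesis by (simp add: distrib_right mult.assoc)
    qed
    then have "B * err \<le> B * (27 + 2 * K) * S"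
      using B by (simp add: mult.assoc mult_left_mono)
    then have bound: "\<bar>\<eta>\<bar> \<le> B * (27 + 2 * K) * S"
      using ln_Z_G_bound unfolding \<eta>_def B_def by linarith
    have "ln (Z G ({1..N} - Y)) = real (N - card Y) * ln (1 - p ^ s) +
        (- (2 * real (card Y) / \<mu> N s p - 1) * (\<Delta> X N E p 2 - \<Delta>2_0 X N E p) + \<eta>)"
    proof -
      have half: "(A\<^sub>N - D\<^sub>N) / 2 = \<Delta> X N E p 2 - \<Delta>2_0 X N E p" by (simp add: A D)
      show ?thesis unfolding \<eta>_def half \<mu>_def mult_minus_left by linarith
    qed
    moreover have "Z G ({1..N} - Y) = exp (ln (Z G ({1..N} - Y)))"
      using Z_G_pos by simp
    moreover have "exp (real (N - card Y) * ln (1 - p ^ s)) = (1 - p ^ s) ^ (N - card Y)"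
      using hyp(5) assms(1) by (simp add: exp_of_nat_mult)
    ultimately have "Z G ({1..N} - Y) = (1 - p ^ s) ^ (N - card Y) *
        exp (- (2 * real (card Y) / \<mu> N s p - 1) * (\<Delta> X N E p 2 - \<Delta>2_0 X N E p) + \<eta>)"
      by (metis exp_add)
    then have "prob_contained_eq X N E p Y =
          (p ^ s) ^ card Y * (1 - p ^ s) ^ (N - card Y) * p powi (- t E s Y) *
          exp (- (2 * real (card Y) / \<mu> N s p - 1) * (\<Delta> X N E p 2 - \<Delta>2_0 X N E p) + \<eta>)"
      unfolding prob_contained_eq_Z p_pow_R by (simp only: mult_ac)
    with bound show ?thesis unfolding S_def by blast
  qed
  show ?thesis
  proof (rule exI[of _ "B * (27 + 2 * K)"], intro conjI allI impI)
    show "B * (27 + 2 * K) > 0" using B assms by simp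
  qed (elim conjE, rule goal; assumption)
qed

end
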